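(* Let $V\in(0,1)$ and $a>0$ be fixed. Then for all sufficiently large $b>a$ the designs $B_I,B_{II}:S\to\{a,b\}$, $$B_I(x_1,x_2)=\chi_{(0,V)}(x_1)\,b+\chi_{(V,1)}(x_1)\,a,\qquad B_{II}(x_1,x_2)=\chi_{(-V/2,V/2)}(x_2)\,b+\bigl(1-\chi_{(-V/2,V/2)}(x_2)\bigr)a,$$ which have the same area $V$ of hard phase $b$, satisfy $$\mathcal{F}(B_{II})<\mathcal{F}(B_I),$$ where $\mathcal{F}$ denotes the compliance. That is, the design $B_{II}$ has strictly better compliance than the design $B_I$.
   Context: Let $S=(0,1)\times(-\tfrac12,\tfrac12)$ and let $\chi_E$ denote the characteristic function of a set $E$. For a design $B\in L^\infty(S)$ with values in $[a,b]$, where $0<a<b$, put $\overline B(x_1)=\int_{-1/2}^{1/2}B(x_1,x_2)\,dx_2$. Let $W^{1,2}_l(0,1)=\{K\in W^{1,2}(0,1):K(0)=0\}$. The force is $f\equiv-e_3$. Let $K[B]\in W^{1,2}_l(0,1)$ be the unique global minimiser over $W^{1,2}_l(0,1)$ of $$K\mapsto\frac12\int_0^1\overline B(t)\,(K'(t))^2\,dt+\int_0^1(1-t)\sin K(t)\,dt$$ (existence and uniqueness of this minimiser are known). It solves the state equation $(\overline BK[B]')'=(1-t)\cos K[B]$ on $(0,1)$ with $K[B](0)=0$ and natural boundary condition $K[B]'(1)=0$, and it takes values in $(-\pi/2,0]$. The compliance of $B$ is $$\mathcal{F}(B)=\int_0^1(1-t)\,|\sin K[B](t)|\,dt.$$ 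*)

theory Defs
  imports "HOL-Analysis.Analysis"
begin

definition rod_domain :: "(real \<times> real) set" where
  "rod_domain = {0<..<1} \<times> {-1/2<..<1/2}"

(* Designs are functions up to null sets, so the two values are required almost everywhere. *)
definition two_phase_design :: "real \<Rightarrow> real \<Rightarrow> (real \<times> real \<Rightarrow> real) \<Rightarrow> bool" where
  "two_phase_design a b B \<longleftrightarrow>
     set_borel_measurable lebesgue rod_domain B \<and>
     (AE x \<in> rod_domain in lebesgue. B x \<in> {a, b})"

definition hard_phase_area :: "real \<Rightarrow> (real \<times> real \<Rightarrow> real) \<Rightarrow> real" where
  "hard_phase_area b B = measure lebesgue {x \<in> rod_domain. B x = b}"

definition cross_section_mean :: "(real \<times> real \<Rightarrow> real) \<Rightarrow> real \<Rightarrow> real" where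
  "cross_section_mean B x1 = (LINT x2:{-1/2<..<1/2}|lebesgue. B (x1, x2))"

(* Test functions are taken in C^1_c(0,1), as in Brezis, Functional Analysis, Sobolev Spaces
   and PDEs, Chapter 8; this gives the same weak derivatives as smooth test functions. *)
definition test_function :: "(real \<Rightarrow> real) \<Rightarrow> bool" where
  "test_function \<phi> \<longleftrightarrow>
     (\<forall>x. \<phi> field_differentiable at x) \<and> continuous_on UNIV (deriv \<phi>) \<and>
     (\<exists>c d. 0 < c \<and> d < 1 \<and> (\<forall>x. x \<notin> {c..d} \<longrightarrow> \<phi> x = 0))"

definition square_integrable :: "(real \<Rightarrow> real) \<Rightarrow> bool" where
  "square_integrable f \<longleftrightarrow>
     set_borel_measurable lebesgue {0<..<1} f \<and>
     set_integrable lebesgue {0<..<1} (\<lambda>t. (f t)\<^sup>2)"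

definition has_weak_derivative :: "(real \<Rightarrow> real) \<Rightarrow> (real \<Rightarrow> real) \<Rightarrow> bool" where
  "has_weak_derivative K g \<longleftrightarrow>
     square_integrable g \<and>
     (\<forall>\<phi>. test_function \<phi> \<longrightarrow>
        (LINT t:{0<..<1}|lebesgue. K t * deriv \<phi> t) = - (LINT t:{0<..<1}|lebesgue. g t * \<phi> t))"

(* Unique up to null sets, so integrals of it do not depend on the choice. *)
definition weak_derivative :: "(real \<Rightarrow> real) \<Rightarrow> real \<Rightarrow> real" where
  "weak_derivative K = (SOME g. has_weak_derivative K g)"

definition W12 :: "(real \<Rightarrow> real) set" where
  "W12 = {K. square_integrable K \<and> (\<exists>g. has_weak_derivative K g)}"

(* K(0) is the value of the representative that is continuous on [0,1]. *)
definition W12_l :: "(real \<Rightarrow> real) set" where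
  "W12_l = {K \<in> W12. continuous_on {0..1} K \<and> K 0 = 0}"

definition energy :: "(real \<times> real \<Rightarrow> real) \<Rightarrow> (real \<Rightarrow> real) \<Rightarrow> real" where
  "energy B K =
     1/2 * (LINT t:{0<..<1}|lebesgue. cross_section_mean B t * (weak_derivative K t)\<^sup>2) +
     (LINT t:{0<..<1}|lebesgue. (1 - t) * sin (K t))"

(* The minimiser is unique on [0,1]; its values elsewhere are arbitrary and never used. *)
definition rod_state :: "(real \<times> real \<Rightarrow> real) \<Rightarrow> real \<Rightarrow> real" where
  "rod_state B = arg_min (energy B) (\<lambda>K. K \<in> W12_l)"

definition compliance :: "(real \<times> real \<Rightarrow> real) \<Rightarrow> real" where
  "compliance B = (LINT t:{0<..<1}|lebesgue. (1 - t) * \<bar>sin (rod_state B t)\<bar>)"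

definition design_I :: "real \<Rightarrow> real \<Rightarrow> real \<Rightarrow> real \<times> real \<Rightarrow> real" where
  "design_I V a b = (\<lambda>(x1, x2). indicator {0<..<V} x1 * b + indicator {V<..<1} x1 * a)"

definition design_II :: "real \<Rightarrow> real \<Rightarrow> real \<Rightarrow> real \<times> real \<Rightarrow> real" where
  "design_II V a b = (\<lambda>(x1, x2).
     indicator {-V/2<..<V/2} x2 * b + (1 - indicator {-V/2<..<V/2} x2) * a)"

end

(* The minimiser K of the energy E satisfies E(K) <= E(L) for every admissible L, and this is all
   that is used about it. For design II the cross-section mean is the constant V b + (1 - V) a, so
   E(K) <= E(0) = 0 forces the L^2 norm of K', hence sup |K| and the compliance, to tend to 0 as b
   grows. For design I a trial state that bends only in the soft part (V,1) has a negative energy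
   -delta not depending on b, and compliance >= -E(K) >= delta.

   Since the state is chosen by arg_min, existence of a minimiser has to be proved. A minimising
   sequence is bounded in C^{1/2}, so by Arzela-Ascoli a subsequence converges uniformly; the load
   term then converges, and the parallelogram identity for the quadratic bending term shows that
   the weak derivatives converge in L^2. *)
theory Submission
  imports Defs "HOL-Complex_Analysis.Great_Picard"
begin

section \<open>Square-integrable functions\<close>

text \<open>Membership in \<open>W12_l\<close> is given by a testing identity under an integral,
  whereas the argument needs point values: sup bounds, equicontinuity, and a use of
  \<open>K 0 = 0\<close>. The bridge is \<open>weak_derivative_FTC\<close>: for continuous
  \<open>K\<close>, the integral of any weak derivative over \<open>(x, y)\<close> is
  \<open>K y - K x\<close>, also when \<open>x = 0\<close> or \<open>y = 1\<close>. It serves twice.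
  With Cauchy-Schwarz it gives the Hoelder bound of exponent 1/2. And since it fixes all integrals
  of a weak derivative over \<open>(0, y)\<close>, it gives uniqueness almost everywhere;
  \<open>energy\<close> refers to a weak derivative picked by choice, and uniqueness is what allows
  it to be computed from an explicit one. The load term is not convex, but it is Lipschitz for the
  sup norm. Between uniformly close states it is therefore a small perturbation of a quadratic form
  bounded below by a positive multiple of the squared L2 norm, and this is why the parallelogram
  identity suffices. Quantitatively, the compliance of design II is at most
  \<open>sqrt (2 / (V * b))\<close>, while the lower bound for design I depends on \<open>V\<close>
  and \<open>a\<close> alone.\<close>

definition L2 :: "'a measure \<Rightarrow> ('a \<Rightarrow> real) \<Rightarrow> bool" where
  "L2 M f \<longleftrightarrow> f \<in> borel_measurable M \<and> integrable M (\<lambda>x. (f x)\<^sup>2)"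

lemma L2_integrable_power2: "L2 M f \<Longrightarrow> integrable M (\<lambda>x. (f x)\<^sup>2)"
  by (simp add: L2_def)

lemma L2_integrable_mult:
  assumes "L2 M f" "L2 M g"
  shows "integrable M (\<lambda>x. f x * g x)"
proof (rule Bochner_Integration.integrable_bound)
  show "integrable M (\<lambda>x. (f x)\<^sup>2 + (g x)\<^sup>2)"
    using assms by (auto simp: L2_def)
  show "(\<lambda>x. f x * g x) \<in> borel_measurable M"
    using assms by (auto simp: L2_def)
  have "\<bar>u * v\<bar> \<le> u\<^sup>2 + v\<^sup>2" for u v :: real
  proof -
    have "0 \<le> (\<bar>u\<bar> - \<bar>v\<bar>)\<^sup>2" "0 \<le> \<bar>u\<bar> * \<bar>v\<bar>" by auto
    moreover have "(\<bar>u\<bar> - \<bar>v\<bar>)\<^sup>2 = u\<^sup>2 + v\<^sup>2 - 2 * (\<bar>u\<bar> * \<bar>v\<bar>)"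
      by (simp add: power2_diff)
    ultimately show ?thesis unfolding abs_mult by linarith
  qed
  then show "AE x in M. norm (f x * g x) \<le> norm ((f x)\<^sup>2 + (g x)\<^sup>2)"
    by (intro AE_I2) simp
qed

lemma L2_add: "L2 M f \<Longrightarrow> L2 M g \<Longrightarrow> L2 M (\<lambda>x. f x + g x)"
  using L2_integrable_mult[of M f g]
  by (auto simp: L2_def power2_sum mult.assoc intro!: Bochner_Integration.integrable_add)

lemma L2_cmult: "L2 M f \<Longrightarrow> L2 M (\<lambda>x. c * f x)"
  by (auto simp: L2_def power_mult_distrib)

lemma L2_diff: "L2 M f \<Longrightarrow> L2 M g \<Longrightarrow> L2 M (\<lambda>x. f x - g x)"
  using L2_add[of M f "\<lambda>x. -1 * g x"] L2_cmult[of M g "-1"] by simp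

lemma L2_bounded_mult:
  assumes "L2 M f" and [measurable]: "h \<in> borel_measurable M" and "\<And>x. x \<in> space M \<Longrightarrow> \<bar>h x\<bar> \<le> C"
  shows "L2 M (\<lambda>x. h x * f x)"
  unfolding L2_def
proof
  have [measurable]: "f \<in> borel_measurable M" using assms by (simp add: L2_def)
  show "(\<lambda>x. h x * f x) \<in> borel_measurable M" by simp
  show "integrable M (\<lambda>x. (h x * f x)\<^sup>2)"
  proof (rule Bochner_Integration.integrable_bound)
    show "integrable M (\<lambda>x. C\<^sup>2 * (f x)\<^sup>2)" using assms by (auto simp: L2_def)
    have "(h x)\<^sup>2 \<le> C\<^sup>2" if "x \<in> space M" for x
      using assms(3)[OF that] by (simp add: abs_le_square_iff[symmetric])
    then show "AE x in M. norm ((h x * f x)\<^sup>2) \<le> norm (C\<^sup>2 * (f x)\<^sup>2)"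
      by (intro AE_I2) (simp add: power_mult_distrib mult_right_mono)
  qed simp
qed

text \<open>The integral of \<open>(f x - t * g x)\<^sup>2\<close> is a quadratic in
  \<open>t\<close> that is never negative.\<close>

lemma L2_Cauchy_Schwarz:
  assumes "L2 M f" "L2 M g"
  shows "(\<integral>x. f x * g x \<partial>M)\<^sup>2 \<le> (\<integral>x. (f x)\<^sup>2 \<partial>M) * (\<integral>x. (g x)\<^sup>2 \<partial>M)"
proof -
  define A B C where "A = (\<integral>x. (f x)\<^sup>2 \<partial>M)" "B = (\<integral>x. f x * g x \<partial>M)" "C = (\<integral>x. (g x)\<^sup>2 \<partial>M)"
  note ABC = this
  have quad: "0 \<le> A - 2 * t * B + t\<^sup>2 * C" for t
  proof -
    have "(\<lambda>x. (f x - t * g x)\<^sup>2) = (\<lambda>x. (f x)\<^sup>2 - (2 * t) * (f x * g x) + t\<^sup>2 * (g x)\<^sup>2)"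
      by (auto simp: power2_eq_square algebra_simps)
    then have "(\<integral>x. (f x - t * g x)\<^sup>2 \<partial>M) = A - 2 * t * B + t\<^sup>2 * C"
      using L2_integrable_mult[OF assms] assms by (simp add: L2_def ABC)
    moreover have "0 \<le> (\<integral>x. (f x - t * g x)\<^sup>2 \<partial>M)" by simp
    ultimately show ?thesis by simp
  qed
  have "0 \<le> C" by (simp add: ABC)
  have "B\<^sup>2 \<le> A * C"
  proof (cases "C = 0")
    case True
    \<comment> \<open>For \<open>C = 0\<close> the quadratic degenerates to
      \<open>A - 2 * t * B\<close>, which would equal -1 at this \<open>t\<close> if
      \<open>B\<close> were nonzero.\<close>
    then have "B = 0" using quad[of "(A + 1) / (2 * B)"] by (cases "B = 0") auto
    then show ?thesis using True by simp
  next
    case False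
    with \<open>0 \<le> C\<close> have "C > 0" by simp
    \<comment> \<open>\<open>B / C\<close> is the minimum point of the quadratic.\<close>
    then show ?thesis using quad[of "B / C"]
      by (simp add: power2_eq_square field_simps)
  qed
  then show ?thesis by (simp add: ABC)
qed

lemma L2_const: "finite_measure M \<Longrightarrow> L2 M (\<lambda>x. c)"
  by (simp add: L2_def finite_measure.integrable_const)

lemma L2_integrable: "finite_measure M \<Longrightarrow> L2 M f \<Longrightarrow> integrable M f"
  using L2_integrable_mult[of M "\<lambda>x. 1" f] L2_const[of M 1] by simp

text \<open>Cauchy-Schwarz against the constant 1; it turns L2 Cauchy sequences into L1 Cauchy
  sequences.\<close>

lemma L1_power2_le_L2:
  assumes "finite_measure M" "L2 M f"
  shows "(\<integral>x. \<bar>f x\<bar> \<partial>M)\<^sup>2 \<le> (\<integral>x. (f x)\<^sup>2 \<partial>M) * measure M (space M)"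
proof -
  interpret finite_measure M by fact
  have "L2 M (\<lambda>x. \<bar>f x\<bar>)" using assms by (auto simp: L2_def)
  from L2_Cauchy_Schwarz[OF this L2_const[of M 1]] show ?thesis
    by (simp add: finite_measure_axioms)
qed

text \<open>By Cauchy-Schwarz, strong convergence implies convergence of inner products. It is used
  to pass to the limit in the testing identity and in the mixed bending term.\<close>

lemma L2_tendsto_inner:
  assumes "\<And>n. L2 M (f n)" "L2 M g" "L2 M h"
    and lim: "(\<lambda>n. \<integral>x. (f n x - g x)\<^sup>2 \<partial>M) \<longlonglongrightarrow> 0"
  shows "(\<lambda>n. \<integral>x. h x * f n x \<partial>M) \<longlonglongrightarrow> (\<integral>x. h x * g x \<partial>M)"
proof -
  have eq: "(\<integral>x. h x * (f n x - g x) \<partial>M) = (\<integral>x. h x * f n x \<partial>M) - (\<integral>x. h x * g x \<partial>M)" for n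
    using L2_integrable_mult[OF assms(3) assms(1)[of n]] L2_integrable_mult[OF assms(3,2)]
    by (simp add: right_diff_distrib)
  have "(\<lambda>n. ((\<integral>x. h x * f n x \<partial>M) - (\<integral>x. h x * g x \<partial>M))\<^sup>2) \<longlonglongrightarrow> 0"
  proof (rule tendsto_sandwich[OF _ _ tendsto_const])
    show "\<forall>\<^sub>F n in sequentially. ((\<integral>x. h x * f n x \<partial>M) - (\<integral>x. h x * g x \<partial>M))\<^sup>2
        \<le> (\<integral>x. (h x)\<^sup>2 \<partial>M) * (\<integral>x. (f n x - g x)\<^sup>2 \<partial>M)"
      using L2_Cauchy_Schwarz[OF assms(3) L2_diff[OF assms(1,2)]] by (simp add: eq)
    show "(\<lambda>n. (\<integral>x. (h x)\<^sup>2 \<partial>M) * (\<integral>x. (f n x - g x)\<^sup>2 \<partial>M)) \<longlonglongrightarrow> 0"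
      using tendsto_mult_left[OF lim] by simp
  qed auto
  then have "(\<lambda>n. (\<integral>x. h x * f n x \<partial>M) - (\<integral>x. h x * g x \<partial>M)) \<longlonglongrightarrow> 0"
    by (simp add: tendsto_null_power)
  then show ?thesis by (simp add: LIM_zero_iff)
qed

text \<open>Riesz-Fischer on a finite measure space. Cauchy in L2 implies Cauchy in L1, which yields
  a subsequence converging almost everywhere; Fatou's lemma then shows that the whole sequence
  converges to this limit in L2.\<close>

lemma L2_complete:
  assumes "finite_measure M" and L2: "\<And>n. L2 M (f n)"
    and Cauchy: "\<And>e. e > 0 \<Longrightarrow> \<exists>N. \<forall>i\<ge>N. \<forall>j\<ge>N. (\<integral>x. (f i x - f j x)\<^sup>2 \<partial>M) < e"
  obtains g where "L2 M g" "(\<lambda>n. \<integral>x. (f n x - g x)\<^sup>2 \<partial>M) \<longlonglongrightarrow> 0"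
proof -
  interpret finite_measure M by fact
  have [measurable]: "f n \<in> borel_measurable M" for n using L2 by (simp add: L2_def)
  have L1: "integrable M (f n)" for n using L2 L2_integrable finite_measure_axioms by blast
  have "\<exists>N. \<forall>i\<ge>N. \<forall>j\<ge>N. (\<integral>x. norm (f i x - f j x) \<partial>M) < e" if "e > 0" for e
  proof -
    \<comment> \<open>The \<open>+ 1\<close> keeps the denominator positive even if the space has
      measure 0.\<close>
    obtain N where N: "\<forall>i\<ge>N. \<forall>j\<ge>N. (\<integral>x. (f i x - f j x)\<^sup>2 \<partial>M) < e\<^sup>2 / (measure M (space M) + 1)"
      using Cauchy[of "e\<^sup>2 / (measure M (space M) + 1)"] \<open>e > 0\<close> by (auto simp: add_nonneg_pos)
    have "(\<integral>x. norm (f i x - f j x) \<partial>M) < e" if "i \<ge> N" "j \<ge> N" for i j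
    proof -
      have "(\<integral>x. norm (f i x - f j x) \<partial>M)\<^sup>2 < e\<^sup>2"
      proof (rule le_less_trans)
        show "(\<integral>x. norm (f i x - f j x) \<partial>M)\<^sup>2 \<le> (\<integral>x. (f i x - f j x)\<^sup>2 \<partial>M) * (measure M (space M) + 1)"
          using L1_power2_le_L2[OF assms(1) L2_diff[OF L2 L2], of i j]
          by (auto simp: distrib_left intro: order_trans)
        show "(\<integral>x. (f i x - f j x)\<^sup>2 \<partial>M) * (measure M (space M) + 1) < e\<^sup>2"
          using N that by (auto simp: pos_less_divide_eq[symmetric] add_nonneg_pos)
      qed
      then show ?thesis using \<open>e > 0\<close> by (simp add: power_less_imp_less_base)
    qed
    then show ?thesis by blast
  qed
  from cauchy_L1_AE_cauchy_subseq[OF L1 this]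
  obtain r where r: "strict_mono r" "AE x in M. Cauchy (\<lambda>i. f (r i) x)" by blast
  define g where "g x = lim (\<lambda>i. f (r i) x)" for x
  have [measurable]: "g \<in> borel_measurable M" unfolding g_def by measurable
  have conv: "AE x in M. (\<lambda>i. f (r i) x) \<longlonglongrightarrow> g x"
    using r(2) by eventually_elim (auto simp: g_def Cauchy_convergent_iff convergent_LIMSEQ_iff)
  \<comment> \<open>Fatou's lemma in the second index. The nonnegative integral is used because
    integrability of \<open>(f n x - g x)\<^sup>2\<close> is only deduced from this bound.\<close>
  have bound: "(\<integral>\<^sup>+x. ennreal ((f n x - g x)\<^sup>2) \<partial>M) \<le> ennreal e"
    if N: "\<forall>i\<ge>N. \<forall>j\<ge>N. (\<integral>x. (f i x - f j x)\<^sup>2 \<partial>M) < e" and "n \<ge> N" for N n e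
  proof -
    have "(\<integral>\<^sup>+x. ennreal ((f n x - g x)\<^sup>2) \<partial>M)
        = (\<integral>\<^sup>+x. liminf (\<lambda>i. ennreal ((f n x - f (r i) x)\<^sup>2)) \<partial>M)"
    proof (rule nn_integral_cong_AE)
      show "AE x in M. ennreal ((f n x - g x)\<^sup>2) = liminf (\<lambda>i. ennreal ((f n x - f (r i) x)\<^sup>2))"
        using conv
      proof eventually_elim
        case (elim x)
        then have "(\<lambda>i. ennreal ((f n x - f (r i) x)\<^sup>2)) \<longlonglongrightarrow> ennreal ((f n x - g x)\<^sup>2)"
          by (intro tendsto_ennrealI tendsto_intros)
        then show ?case by (intro lim_imp_Liminf[symmetric]) auto
      qed
    qed
    also have "\<dots> \<le> liminf (\<lambda>i. \<integral>\<^sup>+x. ennreal ((f n x - f (r i) x)\<^sup>2) \<partial>M)"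
      by (rule nn_integral_liminf) simp
    also have "\<dots> \<le> liminf (\<lambda>i. ennreal e)"
    proof (rule Liminf_mono, rule eventually_sequentiallyI[of N])
      fix i assume "i \<ge> N"
      then have "r i \<ge> N" using seq_suble[OF r(1), of i] by simp
      then have "(\<integral>x. (f n x - f (r i) x)\<^sup>2 \<partial>M) \<le> e"
        using N \<open>n \<ge> N\<close> by (auto intro: less_imp_le)
      then show "(\<integral>\<^sup>+x. ennreal ((f n x - f (r i) x)\<^sup>2) \<partial>M) \<le> ennreal e"
        using L2_diff[OF L2 L2, of n "r i"]
        by (subst nn_integral_eq_integral) (auto simp: L2_def ennreal_leI)
    qed
    finally show ?thesis by (simp add: Liminf_const)
  qed
  have L2n: "L2 M (\<lambda>x. f n x - g x)" and le: "(\<integral>x. (f n x - g x)\<^sup>2 \<partial>M) \<le> e"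
    if "\<forall>i\<ge>N. \<forall>j\<ge>N. (\<integral>x. (f i x - f j x)\<^sup>2 \<partial>M) < e" "n \<ge> N" "e > 0" for N n e
  proof -
    have int: "integrable M (\<lambda>x. (f n x - g x)\<^sup>2)"
      using bound[OF that(1,2)] by (intro integrableI_nonneg) (auto simp: top_unique less_top[symmetric])
    then show "L2 M (\<lambda>x. f n x - g x)" by (simp add: L2_def)
    show "(\<integral>x. (f n x - g x)\<^sup>2 \<partial>M) \<le> e"
      using bound[OF that(1,2)] int \<open>e > 0\<close> by (subst (asm) nn_integral_eq_integral) auto
  qed
  obtain N where "\<forall>i\<ge>N. \<forall>j\<ge>N. (\<integral>x. (f i x - f j x)\<^sup>2 \<partial>M) < 1" using Cauchy[of 1] by auto
  \<comment> \<open>\<open>g\<close> is recovered as \<open>f N - (f N - g)\<close>.\<close>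
  from L2_diff[OF L2 L2n[OF this order_refl], of N] have "L2 M g" by simp
  moreover have "(\<lambda>n. \<integral>x. (f n x - g x)\<^sup>2 \<partial>M) \<longlonglongrightarrow> 0"
  proof (rule LIMSEQ_I)
    fix e :: real assume "e > 0"
    then obtain N where "\<forall>i\<ge>N. \<forall>j\<ge>N. (\<integral>x. (f i x - f j x)\<^sup>2 \<partial>M) < e/2"
      using Cauchy[of "e/2"] by auto
    from le[OF this] \<open>e > 0\<close> show "\<exists>no. \<forall>n\<ge>no. norm ((\<integral>x. (f n x - g x)\<^sup>2 \<partial>M) - 0) < e"
      by (intro exI[of _ N]) fastforce
  qed
  ultimately show ?thesis by (rule that)
qed

section \<open>Weak derivatives on the unit interval\<close>

abbreviation unit_int :: "real measure" where
  "unit_int \<equiv> lebesgue_on {0<..<1}"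

lemma finite_measure_unit_int: "finite_measure unit_int"
  by (rule finite_measureI) (simp add: emeasure_restrict_space)

lemma measure_unit_int: "measure unit_int (space unit_int) = 1"
  by (simp add: measure_restrict_space)

lemma set_integral_unit_int: "(LINT t:{0<..<1}|lebesgue. f t) = (\<integral>t. f t \<partial>unit_int)"
  for f :: "real \<Rightarrow> real"
  by (simp add: set_lebesgue_integral_def integral_restrict_space)

lemma square_integrable_iff_L2: "square_integrable f \<longleftrightarrow> L2 unit_int f"
  unfolding square_integrable_def L2_def set_borel_measurable_def set_integrable_def
  by (simp add: integrable_restrict_space borel_measurable_restrict_space_iff)

lemma continuous_unit_int_measurable:
  fixes f :: "real \<Rightarrow> real"
  assumes "continuous_on {0..1} f"
  shows "f \<in> borel_measurable unit_int"
  by (intro continuous_imp_measurable_on_sets_lebesgue continuous_on_subset[OF assms]) auto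

lemma continuous_bounded_01:
  fixes f :: "real \<Rightarrow> real"
  assumes "continuous_on {0..1} f"
  obtains C where "0 \<le> C" "\<And>x. x \<in> {0..1} \<Longrightarrow> \<bar>f x\<bar> \<le> C"
proof -
  have "bounded (f ` {0..1})"
    using assms by (intro compact_imp_bounded compact_continuous_image) auto
  then obtain C where "\<forall>x\<in>{0..1}. \<bar>f x\<bar> \<le> C" by (auto simp: bounded_iff)
  then show ?thesis by (intro that[of "max C 0"]) (auto simp: le_max_iff_disj)
qed

lemma L2_bounded:
  assumes "f \<in> borel_measurable unit_int" "\<And>x. x \<in> {0<..<1} \<Longrightarrow> \<bar>f x\<bar> \<le> C"
  shows "L2 unit_int f"
  using L2_bounded_mult[OF L2_const[OF finite_measure_unit_int, of 1] assms(1), of C] assms(2)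
  by simp

lemma continuous_L2:
  assumes "continuous_on {0..1} f"
  shows "L2 unit_int f"
proof -
  obtain C where "\<And>x. x \<in> {0..1} \<Longrightarrow> \<bar>f x\<bar> \<le> C" using continuous_bounded_01[OF assms] by metis
  then show ?thesis by (intro L2_bounded[OF continuous_unit_int_measurable[OF assms], of C]) auto
qed

lemma integral_unit_int_const: "(\<integral>t. c \<partial>unit_int) = (c::real)"
  using measure_unit_int by simp

lemma test_function_continuous:
  assumes "test_function \<phi>"
  shows "continuous_on A \<phi>" "continuous_on A (deriv \<phi>)"
proof -
  show "continuous_on A \<phi>"
    using assms by (auto simp: test_function_def
        intro!: continuous_at_imp_continuous_on field_differentiable_imp_continuous_at)
  show "continuous_on A (deriv \<phi>)"
    using assms continuous_on_subset by (auto simp: test_function_def)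
qed

lemma test_function_L2:
  assumes "test_function \<phi>"
  shows "L2 unit_int \<phi>" "L2 unit_int (deriv \<phi>)"
  using test_function_continuous[OF assms] by (auto intro: continuous_L2)

lemma has_weak_derivative_iff:
  "has_weak_derivative K g \<longleftrightarrow> L2 unit_int g \<and>
     (\<forall>\<phi>. test_function \<phi> \<longrightarrow>
        (\<integral>t. K t * deriv \<phi> t \<partial>unit_int) = - (\<integral>t. g t * \<phi> t \<partial>unit_int))"
  by (simp add: has_weak_derivative_def square_integrable_iff_L2 set_integral_unit_int)

lemma has_weak_derivative_combine:
  assumes "L2 unit_int K" "L2 unit_int L" "has_weak_derivative K g" "has_weak_derivative L h"
  shows "has_weak_derivative (\<lambda>t. c * K t + d * L t) (\<lambda>t. c * g t + d * h t)"
  unfolding has_weak_derivative_iff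
proof (intro conjI allI impI)
  have gh: "L2 unit_int g" "L2 unit_int h" using assms by (auto simp: has_weak_derivative_iff)
  then show "L2 unit_int (\<lambda>t. c * g t + d * h t)" by (intro L2_add L2_cmult)
  fix \<phi> assume \<phi>: "test_function \<phi>"
  note T = test_function_L2[OF \<phi>]
  note [simp] = L2_integrable_mult[OF assms(1) T(2)] L2_integrable_mult[OF assms(2) T(2)]
    L2_integrable_mult[OF gh(1) T(1)] L2_integrable_mult[OF gh(2) T(1)]
  have "(\<integral>t. K t * deriv \<phi> t \<partial>unit_int) = - (\<integral>t. g t * \<phi> t \<partial>unit_int)"
    "(\<integral>t. L t * deriv \<phi> t \<partial>unit_int) = - (\<integral>t. h t * \<phi> t \<partial>unit_int)"
    using assms \<phi> by (auto simp: has_weak_derivative_iff)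
  then show "(\<integral>t. (c * K t + d * L t) * deriv \<phi> t \<partial>unit_int)
      = - (\<integral>t. (c * g t + d * h t) * \<phi> t \<partial>unit_int)"
    by (simp add: distrib_right mult.assoc)
qed

text \<open>The weak derivative is a closed operator in L2: for a fixed test function both sides of
  the testing identity are inner products and pass to the limit.\<close>

lemma has_weak_derivative_limit:
  assumes "\<And>n. has_weak_derivative (K n) (g n)" "\<And>n. L2 unit_int (K n)" "L2 unit_int L" "L2 unit_int h"
    and "(\<lambda>n. \<integral>t. (K n t - L t)\<^sup>2 \<partial>unit_int) \<longlonglongrightarrow> 0"
    and "(\<lambda>n. \<integral>t. (g n t - h t)\<^sup>2 \<partial>unit_int) \<longlonglongrightarrow> 0"
  shows "has_weak_derivative L h"
  unfolding has_weak_derivative_iff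
proof (intro conjI allI impI)
  fix \<phi> assume \<phi>: "test_function \<phi>"
  note T = test_function_L2[OF \<phi>]
  have g: "L2 unit_int (g n)" for n using assms(1) by (auto simp: has_weak_derivative_iff)
  have "(\<lambda>n. \<integral>t. deriv \<phi> t * K n t \<partial>unit_int) \<longlonglongrightarrow> (\<integral>t. deriv \<phi> t * L t \<partial>unit_int)"
    by (rule L2_tendsto_inner[OF assms(2,3) T(2) assms(5)])
  moreover have "(\<lambda>n. \<integral>t. \<phi> t * g n t \<partial>unit_int) \<longlonglongrightarrow> (\<integral>t. \<phi> t * h t \<partial>unit_int)"
    by (rule L2_tendsto_inner[OF g assms(4) T(1) assms(6)])
  moreover have "(\<integral>t. deriv \<phi> t * K n t \<partial>unit_int) = - (\<integral>t. \<phi> t * g n t \<partial>unit_int)" for n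
    using assms(1) \<phi> by (auto simp: has_weak_derivative_iff mult.commute)
  ultimately have "(\<integral>t. deriv \<phi> t * L t \<partial>unit_int) = - (\<integral>t. \<phi> t * h t \<partial>unit_int)"
    using LIMSEQ_unique tendsto_minus by simp blast
  then show "(\<integral>t. L t * deriv \<phi> t \<partial>unit_int) = - (\<integral>t. h t * \<phi> t \<partial>unit_int)"
    by (simp add: mult.commute)
qed (fact assms)

text \<open>Integration by parts; the boundary terms vanish because a test function is 0 at 0 and 1.
  This supplies the weak derivatives of the explicit competitors.\<close>

lemma has_weak_derivative_C1:
  assumes "\<And>x. (K has_real_derivative K' x) (at x)" "continuous_on UNIV K'"
  shows "has_weak_derivative K K'"
  unfolding has_weak_derivative_iff
proof (intro conjI allI impI)
  have K: "continuous_on A K" for A using assms(1) by (meson DERIV_continuous continuous_at_imp_continuous_on)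
  have K': "continuous_on A K'" for A using assms(2) continuous_on_subset by blast
  show "L2 unit_int K'" by (intro continuous_L2 K')
  fix \<phi> assume \<phi>: "test_function \<phi>"
  note T = test_function_L2[OF \<phi>]
  have d: "(\<phi> has_real_derivative deriv \<phi> x) (at x)" for x
    using \<phi> by (auto simp: test_function_def DERIV_deriv_iff_field_differentiable)
  have "((\<lambda>t. K t * \<phi> t) has_vector_derivative (K t * deriv \<phi> t + K' t * \<phi> t)) (at t within {0..1})" for t
    unfolding has_real_derivative_iff_has_vector_derivative[symmetric]
    by (auto intro!: derivative_eq_intros assms(1)[THEN has_field_derivative_at_within]
      d[THEN has_field_derivative_at_within])
  then have "((\<lambda>t. K t * deriv \<phi> t + K' t * \<phi> t) has_integral (K 1 * \<phi> 1 - K 0 * \<phi> 0)) {0..1}"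
    by (intro fundamental_theorem_of_calculus) auto
  moreover have "\<phi> 0 = 0" "\<phi> 1 = 0" using \<phi> by (auto simp: test_function_def)
  ultimately have "((\<lambda>t. K t * deriv \<phi> t + K' t * \<phi> t) has_integral 0) {0<..<1}"
    by (simp add: has_integral_Icc_iff_Ioo)
  moreover have i: "integrable unit_int (\<lambda>t. K t * deriv \<phi> t)" "integrable unit_int (\<lambda>t. K' t * \<phi> t)"
    using continuous_L2[OF K] continuous_L2[OF K'] T by (auto intro: L2_integrable_mult)
  then have "((\<lambda>t. K t * deriv \<phi> t + K' t * \<phi> t) has_integral
      (\<integral>t. K t * deriv \<phi> t + K' t * \<phi> t \<partial>unit_int)) {0<..<1}"
    by (intro has_integral_integral_lebesgue_on) auto
  ultimately have "(\<integral>t. K t * deriv \<phi> t + K' t * \<phi> t \<partial>unit_int) = 0"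
    by (rule has_integral_unique[symmetric])
  then show "(\<integral>t. K t * deriv \<phi> t \<partial>unit_int) = - (\<integral>t. K' t * \<phi> t \<partial>unit_int)"
    using i by simp
qed

section \<open>A continuously differentiable cut-off and the approximate identity that it
  generates\<close>

lemma DERIV_max_0_power2:
  fixes x :: real
  shows "((\<lambda>x. (max 0 x)\<^sup>2) has_real_derivative 2 * max 0 x) (at x)"
proof (cases x "0::real" rule: linorder_cases)
  case less
  have "((\<lambda>x. (max 0 x)\<^sup>2) has_real_derivative 0) (at x)"
    by (rule has_field_derivative_transform_within_open[of "\<lambda>x. 0" _ _ "{..<0}"]) (use less in auto)
  with less show ?thesis by simp
next
  case greater
  have "((\<lambda>x. x\<^sup>2) has_real_derivative 2 * x) (at x)"
    by (auto intro!: derivative_eq_intros)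
  then have "((\<lambda>x. (max 0 x)\<^sup>2) has_real_derivative 2 * x) (at x)"
    by (rule has_field_derivative_transform_within_open[of _ _ _ "{0<..}"]) (use greater in auto)
  with greater show ?thesis by simp
next
  case equal
  \<comment> \<open>At the kink the difference quotient is bounded by
    \<open>\<bar>h\<bar>\<close>.\<close>
  have "((\<lambda>h. (max 0 h)\<^sup>2 / h) \<longlongrightarrow> 0) (at (0::real))"
  proof (rule Lim_null_comparison)
    show "\<forall>\<^sub>F h in at 0. norm ((max 0 h)\<^sup>2 / h) \<le> \<bar>h::real\<bar>"
      by (rule always_eventually) (auto simp: max_def power2_eq_square)
    show "((\<lambda>h. \<bar>h\<bar>) \<longlongrightarrow> 0) (at (0::real))" by (intro tendsto_rabs_zero tendsto_ident_at)
  qed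
  then show ?thesis using equal by (simp add: DERIV_def)
qed

text \<open>Second differences of \<open>(max 0 u)\<^sup>2\<close> give a step from 0 to 1 that is \<open>C\<^sup>1\<close>, which is all that
  a test function has to be.\<close>

definition smooth_step :: "real \<Rightarrow> real" where
  "smooth_step u = 2 * ((max 0 u)\<^sup>2 - 2 * (max 0 (u - 1/2))\<^sup>2 + (max 0 (u - 1))\<^sup>2)"

text \<open>The derivative of \<open>smooth_step\<close>: a triangle of height 2 over [0,1], hence
  of area 1, which serves as a mollifying kernel.\<close>

definition hat :: "real \<Rightarrow> real" where
  "hat u = 4 * (max 0 u - 2 * max 0 (u - 1/2) + max 0 (u - 1))"

lemma DERIV_smooth_step: "(smooth_step has_real_derivative hat u) (at u)"
proof -
  have *: "((\<lambda>u. (max 0 (u - c))\<^sup>2) has_real_derivative 2 * max 0 (u - c)) (at u)" for c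
  proof -
    have "((\<lambda>u. u - c) has_real_derivative 1) (at u)" by (auto intro!: derivative_eq_intros)
    from DERIV_chain2[OF DERIV_max_0_power2 this] show ?thesis by simp
  qed
  show ?thesis unfolding smooth_step_def[abs_def] hat_def
    by (rule derivative_eq_intros DERIV_max_0_power2 * refl | simp)+
qed

lemma continuous_on_hat: "continuous_on A hat"
  unfolding hat_def by (intro continuous_intros)

lemma hat_measurable [measurable]: "hat \<in> borel_measurable borel"
  by (intro borel_measurable_continuous_onI continuous_on_hat)

lemma smooth_step_simps: "u \<le> 0 \<Longrightarrow> smooth_step u = 0" "1 \<le> u \<Longrightarrow> smooth_step u = 1"
  by (auto simp: smooth_step_def max_def power2_eq_square algebra_simps)

lemma hat_eq_0: "u \<notin> {0<..<1} \<Longrightarrow> hat u = 0"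
  by (auto simp: hat_def max_def)

lemma hat_nonneg: "0 \<le> hat u"
  by (auto simp: hat_def max_def)

text \<open>\<open>smooth_step\<close> is monotone because \<open>hat\<close> is nonnegative, and it
  is constant on either side of [0,1].\<close>

lemma smooth_step_bounds: "0 \<le> smooth_step u" "smooth_step u \<le> 1"
proof -
  have "mono smooth_step"
  proof (rule monoI)
    fix x y :: real assume "x \<le> y"
    then show "smooth_step x \<le> smooth_step y"
      by (rule DERIV_nonneg_imp_nondecreasing) (use DERIV_smooth_step hat_nonneg in blast)
  qed
  then have "smooth_step (min u 0) \<le> smooth_step u" "smooth_step u \<le> smooth_step (max u 1)"
    by (auto intro: monoD)
  then show "0 \<le> smooth_step u" "smooth_step u \<le> 1" by (auto simp: smooth_step_simps)
qed

lemma integral_hat: "integrable lborel hat" "(\<integral>u. hat u \<partial>lborel) = 1"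
proof -
  have eq: "hat = (\<lambda>u. indicator {0..1} u *\<^sub>R hat u)"
  proof
    fix u show "hat u = indicator {0..1} u *\<^sub>R hat u"
      using hat_eq_0[of u] by (cases "u \<in> {0..1}") auto
  qed
  have "(\<integral>u. indicator {0..1} u *\<^sub>R hat u \<partial>lborel) = smooth_step 1 - smooth_step 0"
  proof (rule integral_FTC_atLeastAtMost[OF _ _ continuous_on_hat])
    fix x show "(smooth_step has_vector_derivative hat x) (at x within {0..1})"
      using DERIV_smooth_step[of x, THEN has_field_derivative_at_within]
      unfolding has_real_derivative_iff_has_vector_derivative .
  qed simp
  then show "(\<integral>u. hat u \<partial>lborel) = 1"
    by (subst eq) (simp add: smooth_step_simps)
  have "set_integrable lborel {0..1} hat"
    by (rule borel_integrable_atLeastAtMost'[OF continuous_on_hat])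
  then show "integrable lborel hat"
    unfolding set_integrable_def by (subst eq)
qed

text \<open>The substitution \<open>t = p n + c n * u\<close> turns the shrinking kernel into the
  fixed kernel \<open>hat\<close>, and dominated convergence applies. The width \<open>c n\<close>
  is signed: a negative one mirrors the kernel, so that it lies to the left of \<open>p n\<close>.
  The assumption \<open>mem\<close> keeps the support inside (0,1), and so a limit point
  \<open>P\<close> at an end of [0,1] is allowed.\<close>

lemma hat_approximate_identity:
  assumes K: "continuous_on {0..1} K" and P: "P \<in> {0..1}"
    and p: "p \<longlonglongrightarrow> P" and c: "c \<longlonglongrightarrow> 0" "\<And>n. c n \<noteq> 0"
    and mem: "\<forall>\<^sub>F n in sequentially. \<forall>u\<in>{0<..<1}. p n + c n * u \<in> {0<..<1::real}"
  shows "(\<lambda>n. \<integral>t. K t * (hat ((t - p n) / c n) / \<bar>c n\<bar>) \<partial>unit_int) \<longlonglongrightarrow> K P"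
proof -
  obtain C where C: "0 \<le> C" "\<And>x. x \<in> {0..1} \<Longrightarrow> \<bar>K x\<bar> \<le> C"
    using continuous_bounded_01[OF K] by blast
  \<comment> \<open>Outside [0,1] nothing is known of \<open>K\<close>; cut off, it is a bounded
    Borel function on the whole line, to which the affine substitution for \<open>lborel\<close>
    applies.\<close>
  define k where "k t = indicator {0<..<1} t *\<^sub>R K t" for t
  have [measurable]: "k \<in> borel_measurable borel"
    unfolding k_def by (intro borel_measurable_continuous_on_indicator continuous_on_subset[OF K]) auto
  have k: "\<bar>k t\<bar> \<le> C" for t using C by (auto simp: k_def indicator_def)
  have eq: "(\<integral>t. K t * (hat ((t - p n) / c n) / \<bar>c n\<bar>) \<partial>unit_int)
      = (\<integral>u. k (p n + c n * u) * hat u \<partial>lborel)" for n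
  proof -
    have "(\<integral>t. K t * (hat ((t - p n) / c n) / \<bar>c n\<bar>) \<partial>unit_int)
        = (\<integral>t. k t * (hat ((t - p n) / c n) / \<bar>c n\<bar>) \<partial>lebesgue)"
      by (subst integral_restrict_space) (simp_all add: k_def mult.assoc)
    also have "\<dots> = (\<integral>t. k t * (hat ((t - p n) / c n) / \<bar>c n\<bar>) \<partial>lborel)"
      by (rule integral_completion) simp
    also have "\<dots> = \<bar>c n\<bar> *\<^sub>R (\<integral>u. k (p n + c n * u) * (hat u / \<bar>c n\<bar>) \<partial>lborel)"
      using c(2)[of n] by (subst lborel_integral_real_affine[where c = "c n" and t = "p n"]) simp_all
    finally show ?thesis using c(2)[of n] by simp
  qed
  have "(\<lambda>n. \<integral>u. k (p n + c n * u) * hat u \<partial>lborel) \<longlonglongrightarrow> (\<integral>u. K P * hat u \<partial>lborel)"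
  proof (rule integral_dominated_convergence[where w = "\<lambda>u. C * hat u"])
    show "integrable lborel (\<lambda>u. C * hat u)" using integral_hat by simp
    show "AE u in lborel. norm (k (p n + c n * u) * hat u) \<le> C * hat u" for n
      using k hat_nonneg by (intro AE_I2) (auto simp: abs_mult intro!: mult_right_mono)
    show "AE u in lborel. (\<lambda>n. k (p n + c n * u) * hat u) \<longlonglongrightarrow> K P * hat u"
    proof (rule AE_I2)
      fix u :: real
      show "(\<lambda>n. k (p n + c n * u) * hat u) \<longlonglongrightarrow> K P * hat u"
      proof (cases "u \<in> {0<..<1}")
        case False
        then show ?thesis using hat_eq_0 by simp
      next
        case True
        from mem have m: "\<forall>\<^sub>F n in sequentially. p n + c n * u \<in> {0<..<1}"
          by eventually_elim (use True in blast)
        have "(\<lambda>n. p n + c n * u) \<longlonglongrightarrow> P + 0 * u" by (intro tendsto_intros p c)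
        then have "(\<lambda>n. K (p n + c n * u)) \<longlonglongrightarrow> K P"
          using m by (intro continuous_on_tendsto_compose[OF K _ P]) (auto elim: eventually_mono)
        moreover have "\<forall>\<^sub>F n in sequentially. K (p n + c n * u) = k (p n + c n * u)"
          using m by eventually_elim (simp add: k_def)
        ultimately have "(\<lambda>n. k (p n + c n * u)) \<longlonglongrightarrow> K P"
          by (rule Lim_transform_eventually)
        then show ?thesis by (intro tendsto_intros)
      qed
    qed
  qed simp_all
  then show ?thesis unfolding eq by (simp add: integral_hat)
qed

section \<open>Recovering point values from a weak derivative, and its uniqueness\<close>

lemma indicator_mult_L2:
  assumes "L2 unit_int g" "S \<in> sets lebesgue"
  shows "L2 unit_int (\<lambda>t. indicator S t * g t)"
proof (rule L2_bounded_mult[OF assms(1), of _ 1])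
  show "indicat_real S \<in> borel_measurable unit_int"
    using assms(2) by (simp add: measurable_restrict_space1)
qed (simp add: indicator_def)

text \<open>The identity would follow at once from testing with the indicator of
  \<open>(x, y)\<close>. That is no test function, so it is approximated from inside; continuity of
  \<open>K\<close> then turns averages near the endpoints into the values \<open>K x\<close> and
  \<open>K y\<close>.\<close>

lemma weak_derivative_FTC:
  assumes K: "continuous_on {0..1} K" and g: "has_weak_derivative K g"
    and xy: "0 \<le> x" "x < y" "y \<le> 1"
  shows "(\<integral>t. indicator {x<..<y} t * g t \<partial>unit_int) = K y - K x"
proof -
  have g2: "L2 unit_int g" using g by (simp add: has_weak_derivative_iff)
  define \<epsilon> where "\<epsilon> n = inverse (real (Suc n))" for n
  have \<epsilon>: "\<epsilon> \<longlonglongrightarrow> 0" "\<And>n. 0 < \<epsilon> n"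
    unfolding \<epsilon>_def using LIMSEQ_inverse_real_of_nat by auto
  have small: "\<forall>\<^sub>F n in sequentially. \<epsilon> n < r" if "0 < r" for r
    using order_tendstoD(2)[OF \<epsilon>(1) that] .
  \<comment> \<open>The smoothed indicator rises on
    \<open>[x + \<epsilon> n, x + 2 * \<epsilon> n]\<close> and falls on
    \<open>[y - 2 * \<epsilon> n, y - \<epsilon> n]\<close>. The first bound keeps both ramps inside
    \<open>(x, y)\<close>; the second makes them disjoint.\<close>
  have sm: "\<forall>\<^sub>F n in sequentially. \<epsilon> n < (y - x) / 2" "\<forall>\<^sub>F n in sequentially. \<epsilon> n < (y - x) / 4"
    using small[of "(y - x) / 2"] small[of "(y - x) / 4"] xy by fastforce+
  \<comment> \<open>Smoothed indicators of the interval, shrunk by \<open>\<epsilon> n\<close> so that they vanish near 0 and 1 even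
    for \<open>x = 0\<close>, \<open>y = 1\<close>; their derivatives are approximate point masses at \<open>x\<close> and \<open>y\<close>.\<close>
  define \<phi> where "\<phi> n t = smooth_step ((t - (x + \<epsilon> n)) / \<epsilon> n) + smooth_step ((t - (y - \<epsilon> n)) / - \<epsilon> n) - 1"
    for n t
  define D1 D2 where "D1 n t = hat ((t - (x + \<epsilon> n)) / \<epsilon> n) / \<epsilon> n"
    and "D2 n t = hat ((t - (y - \<epsilon> n)) / - \<epsilon> n) / \<epsilon> n" for n t
  have D: "(\<phi> n has_real_derivative D1 n t - D2 n t) (at t)" for n t
  proof -
    have "((\<lambda>t. (t - a) / b) has_real_derivative 1 / b) (at t)" for a b :: real
      by (intro DERIV_cdivide) (auto intro!: derivative_eq_intros)
    note * = DERIV_chain2[OF DERIV_smooth_step this]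
    have "(\<phi> n has_real_derivative
        hat ((t - (x + \<epsilon> n)) / \<epsilon> n) * (1 / \<epsilon> n)
        + hat ((t - (y - \<epsilon> n)) / - \<epsilon> n) * (1 / - \<epsilon> n) - 0) (at t)"
      unfolding \<phi>_def[abs_def] by (intro DERIV_diff DERIV_add * DERIV_const)
    then show ?thesis by (simp add: D1_def D2_def)
  qed
  have cont: "continuous_on A (D1 n)" "continuous_on A (D2 n)" for A n
    unfolding D1_def D2_def using \<epsilon>(2)[of n]
    by (auto intro!: continuous_intros continuous_on_compose2[OF continuous_on_hat[of UNIV]])
  have eq: "(\<integral>t. K t * D1 n t \<partial>unit_int) - (\<integral>t. K t * D2 n t \<partial>unit_int)
      = - (\<integral>t. g t * \<phi> n t \<partial>unit_int)" if n: "\<epsilon> n < (y - x) / 4" for n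
  proof -
    have d: "deriv (\<phi> n) = (\<lambda>t. D1 n t - D2 n t)" using D by (intro ext DERIV_imp_deriv)
    have "test_function (\<phi> n)"
      unfolding test_function_def
    proof (intro conjI exI allI impI)
      show "\<phi> n field_differentiable at t" for t using D field_differentiable_def by blast
      show "continuous_on UNIV (deriv (\<phi> n))" unfolding d by (intro continuous_intros cont)
      show "0 < x + \<epsilon> n" "y - \<epsilon> n < 1" using xy \<epsilon>(2)[of n] by auto
      fix t assume "t \<notin> {x + \<epsilon> n..y - \<epsilon> n}"
      then consider "t < x + \<epsilon> n" | "y - \<epsilon> n < t" by fastforce
      then show "\<phi> n t = 0"
      proof cases
        case 1
        then have "(t - (x + \<epsilon> n)) / \<epsilon> n \<le> 0" "1 \<le> (t - (y - \<epsilon> n)) / - \<epsilon> n"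
          using \<epsilon>(2)[of n] n by (simp_all add: field_simps)
        then show ?thesis by (simp add: \<phi>_def smooth_step_simps)
      next
        case 2
        then have "1 \<le> (t - (x + \<epsilon> n)) / \<epsilon> n" "(t - (y - \<epsilon> n)) / - \<epsilon> n \<le> 0"
          using \<epsilon>(2)[of n] n by (simp_all add: field_simps)
        then show ?thesis by (simp add: \<phi>_def smooth_step_simps)
      qed
    qed
    with g have "(\<integral>t. K t * deriv (\<phi> n) t \<partial>unit_int) = - (\<integral>t. g t * \<phi> n t \<partial>unit_int)"
      by (simp only: has_weak_derivative_iff)
    then have "(\<integral>t. K t * (D1 n t - D2 n t) \<partial>unit_int) = - (\<integral>t. g t * \<phi> n t \<partial>unit_int)"
      by (simp only: d)
    moreover have "integrable unit_int (\<lambda>t. K t * D1 n t)" "integrable unit_int (\<lambda>t. K t * D2 n t)"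
      by (intro L2_integrable_mult continuous_L2 K cont)+
    ultimately show ?thesis by (simp add: right_diff_distrib)
  qed
  have "(\<lambda>n. \<integral>t. K t * (hat ((t - (x + \<epsilon> n)) / \<epsilon> n) / \<bar>\<epsilon> n\<bar>) \<partial>unit_int) \<longlonglongrightarrow> K x"
  proof (rule hat_approximate_identity[OF K])
    show "(\<lambda>n. x + \<epsilon> n) \<longlonglongrightarrow> x" using tendsto_add[OF tendsto_const[of x] \<epsilon>(1)] by simp
    show "\<forall>\<^sub>F n in sequentially. \<forall>u\<in>{0<..<1}. x + \<epsilon> n + \<epsilon> n * u \<in> {0<..<1}"
      using sm(1)
    proof eventually_elim
      case (elim n)
      show ?case
      proof
        fix u :: real assume u: "u \<in> {0<..<1}"
        define w where "w = \<epsilon> n * u"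
        have "0 < w" "w < \<epsilon> n" using \<epsilon>(2)[of n] u by (auto simp: w_def)
        then have "0 < x + \<epsilon> n + w \<and> x + \<epsilon> n + w < 1"
          using elim xy \<epsilon>(2)[of n] by (simp add: field_simps)
        then show "x + \<epsilon> n + \<epsilon> n * u \<in> {0<..<1}" by (simp add: w_def)
      qed
    qed
  qed (use xy \<epsilon> in \<open>auto simp: less_imp_neq[symmetric]\<close>)
  then have 1: "(\<lambda>n. \<integral>t. K t * D1 n t \<partial>unit_int) \<longlonglongrightarrow> K x"
    using \<epsilon>(2) by (simp add: D1_def abs_of_pos)
  have "(\<lambda>n. \<integral>t. K t * (hat ((t - (y - \<epsilon> n)) / - \<epsilon> n) / \<bar>- \<epsilon> n\<bar>) \<partial>unit_int) \<longlonglongrightarrow> K y"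
  proof (rule hat_approximate_identity[OF K])
    show "(\<lambda>n. y - \<epsilon> n) \<longlonglongrightarrow> y" using tendsto_diff[OF tendsto_const[of y] \<epsilon>(1)] by simp
    show "(\<lambda>n. - \<epsilon> n) \<longlonglongrightarrow> 0" using tendsto_minus[OF \<epsilon>(1)] by simp
    show "\<forall>\<^sub>F n in sequentially. \<forall>u\<in>{0<..<1}. y - \<epsilon> n + - \<epsilon> n * u \<in> {0<..<1}"
      using sm(1)
    proof eventually_elim
      case (elim n)
      show ?case
      proof
        fix u :: real assume u: "u \<in> {0<..<1}"
        define w where "w = \<epsilon> n * u"
        have "0 < w" "w < \<epsilon> n" using \<epsilon>(2)[of n] u by (auto simp: w_def)
        then have "0 < y - \<epsilon> n - w \<and> y - \<epsilon> n - w < 1"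
          using elim xy \<epsilon>(2)[of n] by (simp add: field_simps)
        then show "y - \<epsilon> n + - \<epsilon> n * u \<in> {0<..<1}" by (simp add: w_def)
      qed
    qed
  qed (use xy \<epsilon> in \<open>auto simp: less_imp_neq[symmetric]\<close>)
  then have 2: "(\<lambda>n. \<integral>t. K t * D2 n t \<partial>unit_int) \<longlonglongrightarrow> K y"
    using \<epsilon>(2) by (simp add: D2_def abs_of_pos)
  have 3: "(\<lambda>n. \<integral>t. g t * \<phi> n t \<partial>unit_int) \<longlonglongrightarrow> (\<integral>t. indicator {x<..<y} t * g t \<partial>unit_int)"
  proof (rule integral_dominated_convergence[where w = "\<lambda>t. \<bar>g t\<bar>"])
    have [measurable]: "g \<in> borel_measurable unit_int" using g2 by (simp add: L2_def)
    have [measurable]: "\<phi> n \<in> borel_measurable unit_int" for n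
      using D by (intro continuous_unit_int_measurable) (meson DERIV_continuous continuous_at_imp_continuous_on)
    show "(\<lambda>t. g t * \<phi> n t) \<in> borel_measurable unit_int" for n by simp
    show "(\<lambda>t. indicator {x<..<y} t * g t) \<in> borel_measurable unit_int"
      using indicator_mult_L2[OF g2, of "{x<..<y}"] by (simp add: L2_def)
    show "integrable unit_int (\<lambda>t. \<bar>g t\<bar>)"
      using L2_integrable[OF finite_measure_unit_int g2] by simp
    have "\<bar>\<phi> n t\<bar> \<le> 1" for n t
      using smooth_step_bounds[of "(t - (x + \<epsilon> n)) / \<epsilon> n"] smooth_step_bounds[of "(t - (y - \<epsilon> n)) / - \<epsilon> n"]
      by (auto simp: \<phi>_def)
    then show "AE t in unit_int. norm (g t * \<phi> n t) \<le> \<bar>g t\<bar>" for n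
      by (intro AE_I2) (auto simp: abs_mult mult_left_le)
    have lim: "(\<lambda>n. \<phi> n t) \<longlonglongrightarrow> indicator {x<..<y} t" for t
    proof (rule tendsto_eventually)
      consider "t \<le> x" | "y \<le> t" | "x < t" "t < y" by linarith
      then show "\<forall>\<^sub>F n in sequentially. \<phi> n t = indicator {x<..<y} t"
      proof cases
        case 1
        show ?thesis using sm(1)
        proof eventually_elim
          case (elim n)
          then have "(t - (x + \<epsilon> n)) / \<epsilon> n \<le> 0" "1 \<le> (t - (y - \<epsilon> n)) / - \<epsilon> n"
            using \<epsilon>(2)[of n] 1 by (simp_all add: field_simps)
          then show ?case using 1 by (simp add: \<phi>_def smooth_step_simps)
        qed
      next
        case 2
        show ?thesis using sm(1)
        proof eventually_elim
          case (elim n)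
          then have "1 \<le> (t - (x + \<epsilon> n)) / \<epsilon> n" "(t - (y - \<epsilon> n)) / - \<epsilon> n \<le> 0"
            using \<epsilon>(2)[of n] 2 by (simp_all add: field_simps)
          then show ?case using 2 by (simp add: \<phi>_def smooth_step_simps)
        qed
      next
        case 3
        have "\<forall>\<^sub>F n in sequentially. \<epsilon> n < (t - x) / 2" "\<forall>\<^sub>F n in sequentially. \<epsilon> n < (y - t) / 2"
          using small[of "(t - x) / 2"] small[of "(y - t) / 2"] 3 by fastforce+
        then show ?thesis
        proof eventually_elim
          case (elim n)
          then have "1 \<le> (t - (x + \<epsilon> n)) / \<epsilon> n" "1 \<le> (t - (y - \<epsilon> n)) / - \<epsilon> n"
            using \<epsilon>(2)[of n] 3 by (simp_all add: field_simps)
          then show ?case using 3 by (simp add: \<phi>_def smooth_step_simps)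
        qed
      qed
    qed
    have "(\<lambda>n. g t * \<phi> n t) \<longlonglongrightarrow> g t * indicator {x<..<y} t" for t
      by (intro tendsto_intros lim)
    then show "AE t in unit_int. (\<lambda>n. g t * \<phi> n t) \<longlonglongrightarrow> indicator {x<..<y} t * g t"
      by (simp add: mult.commute)
  qed
  have "(\<lambda>n. - (\<integral>t. g t * \<phi> n t \<partial>unit_int)) \<longlonglongrightarrow> K x - K y"
  proof (rule Lim_transform_eventually[OF tendsto_diff[OF 1 2]])
    show "\<forall>\<^sub>F n in sequentially. (\<integral>t. K t * D1 n t \<partial>unit_int) - (\<integral>t. K t * D2 n t \<partial>unit_int)
        = - (\<integral>t. g t * \<phi> n t \<partial>unit_int)"
      using sm(2) by eventually_elim (rule eq)
  qed
  from LIMSEQ_unique[OF this tendsto_minus[OF 3]] show ?thesis by simp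
qed

text \<open>Dynkin's argument: the Borel sets over which the integral vanishes are closed under
  complements and countable disjoint unions, and they contain the half-lines, an intersection-stable
  generator.\<close>

lemma AE_zero_if_interval_integrals_zero:
  assumes f: "integrable unit_int f"
    and zero: "\<And>y. 0 < y \<Longrightarrow> y \<le> 1 \<Longrightarrow> (\<integral>t. indicator {0<..<y} t * f t \<partial>unit_int) = (0::real)"
  shows "AE t in unit_int. f t = 0"
proof -
  \<comment> \<open>Extension by zero, so that half-lines of the whole real line can serve as
    generator.\<close>
  define F where "F t = indicator {0<..<1} t *\<^sub>R f t" for t :: real
  have F: "integrable lebesgue F"
    using f by (simp add: F_def[abs_def] integrable_restrict_space)
  have int: "set_integrable lebesgue A F" if "A \<in> sets lebesgue" for A
    unfolding set_integrable_def by (rule integrable_mult_indicator[OF that F])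
  have ray: "(LINT t:{..<a}|lebesgue. F t) = 0" for a
  proof -
    have "(LINT t:{..<a}|lebesgue. F t) = (\<integral>t. indicator {..<a} t * f t \<partial>unit_int)"
      by (subst integral_restrict_space)
        (auto simp: set_lebesgue_integral_def F_def mult.left_commute)
    also have "\<dots> = (\<integral>t. indicator {0<..<min a 1} t * f t \<partial>unit_int)"
      by (rule Bochner_Integration.integral_cong) (auto simp: indicator_def)
    also have "\<dots> = 0"
    proof (cases "a \<le> 0")
      case True
      then have "{0<..<min a 1} = {}" by auto
      then show ?thesis by simp
    next
      case False
      then show ?thesis by (intro zero) auto
    qed
    finally show ?thesis .
  qed
  \<comment> \<open>The complement step of the induction needs the total integral; as
    \<open>F\<close> vanishes off (0,1), the half-line up to 1 already carries all of it.\<close>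
  have all: "(LINT t:UNIV|lebesgue. F t) = 0"
  proof -
    have "(LINT t:UNIV|lebesgue. F t) = (LINT t:{..<1}|lebesgue. F t)"
      unfolding set_lebesgue_integral_def
      by (rule Bochner_Integration.integral_cong) (auto simp: F_def indicator_def)
    then show ?thesis using ray by simp
  qed
  have borel: "(LINT t:A|lebesgue. F t) = 0" if "A \<in> sets borel" for A
  proof -
    have *: "sigma_sets UNIV (range lessThan) = sets (borel :: real measure)"
      by (subst borel_Iio) simp
    have sub: "sigma_sets UNIV (range lessThan) \<subseteq> sets (lebesgue :: real measure)"
      unfolding * by auto
    have "{..<x} \<inter> {..<y} = {..<min x y}" for x y :: real by auto
    then have "Int_stable (range (lessThan :: real \<Rightarrow> _))"
      by (auto simp: Int_stable_def)
    moreover have "range lessThan \<subseteq> Pow (UNIV :: real set)" by simp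
    moreover have "A \<in> sigma_sets UNIV (range lessThan)" using that * by simp
    ultimately show ?thesis
    proof (induction A rule: sigma_sets_induct_disjoint)
      case (basic A)
      then show ?case using ray by auto
    next
      case empty
      then show ?case by (simp add: set_lebesgue_integral_def)
    next
      case (compl A)
      then have A: "A \<in> sets lebesgue" using sub by blast
      have "(LINT t:A \<union> (UNIV - A)|lebesgue. F t) = (LINT t:A|lebesgue. F t) + (LINT t:UNIV - A|lebesgue. F t)"
        using A by (intro set_integral_Un int) auto
      then show ?case using compl all by simp
    next
      case (union A)
      then have A: "A i \<in> sets lebesgue" for i using sub by blast
      have "(LINT t:(\<Union>i. A i)|lebesgue. F t) = (\<Sum>i. LINT t:A i|lebesgue. F t)"
        using A union(1) by (intro lebesgue_integral_countable_add int) (auto simp: disjoint_family_on_def)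
      then show ?case using union by simp
    qed
  qed
  \<comment> \<open>The sets witnessing sigma-finiteness of \<open>lborel\<close> also witness it
    for the completion, which agrees with \<open>lborel\<close> on them.\<close>
  interpret sigma_finite_measure "lebesgue :: real measure"
  proof
    obtain A :: "real set set" where "countable A" "A \<subseteq> sets lborel" "\<Union>A = space lborel"
        "\<forall>a\<in>A. emeasure lborel a \<noteq> \<infinity>"
      using lborel.sigma_finite_countable by blast
    then show "\<exists>A::real set set. countable A \<and> A \<subseteq> sets lebesgue \<and> \<Union>A = space lebesgue
        \<and> (\<forall>a\<in>A. emeasure lebesgue a \<noteq> \<infinity>)"
      by (intro exI[of _ A]) (auto simp: subset_eq)
  qed
  have "AE t in lebesgue. F t = 0"
  proof (rule density_zero[OF F])
    \<comment> \<open>A Lebesgue set differs from a Borel set by a null set, which the integral does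
      not see.\<close>
    fix A :: "real set" assume A: "A \<in> sets lebesgue"
    then obtain S N N' where SN: "A = S \<union> N" "N \<subseteq> N'" "N' \<in> null_sets lborel" "S \<in> sets lborel"
      by (rule sets_completionE)
    have "(A - S) \<union> (S - A) \<in> null_sets lebesgue"
      using SN by (intro null_sets_completion_subset[OF _ null_sets_completionI[OF SN(3)]]) auto
    then have "(LINT t:A|lebesgue. F t) = (LINT t:S|lebesgue. F t)"
      using A SN by (intro set_integral_null_delta F) auto
    then show "(LINT t:A|lebesgue. F t) = 0" using borel SN by simp
  qed
  then show ?thesis
    by (subst AE_restrict_space_iff) (auto simp: F_def elim: eventually_mono)
qed

text \<open>By \<open>weak_derivative_FTC\<close> both candidates have integral
  \<open>K y - K 0\<close> over every \<open>(0, y)\<close>.\<close>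

lemma weak_derivative_unique:
  assumes "continuous_on {0..1} K" "has_weak_derivative K g" "has_weak_derivative K h"
  shows "AE t in unit_int. g t = h t"
proof -
  have gh: "L2 unit_int g" "L2 unit_int h" using assms by (auto simp: has_weak_derivative_iff)
  note I = L2_integrable[OF finite_measure_unit_int]
  have "AE t in unit_int. g t - h t = 0"
  proof (rule AE_zero_if_interval_integrals_zero)
    show "integrable unit_int (\<lambda>t. g t - h t)" using I[OF gh(1)] I[OF gh(2)] by simp
    fix y :: real assume y: "0 < y" "y \<le> 1"
    have "(\<integral>t. indicator {0<..<y} t * (g t - h t) \<partial>unit_int)
        = (\<integral>t. indicator {0<..<y} t * g t \<partial>unit_int) - (\<integral>t. indicator {0<..<y} t * h t \<partial>unit_int)"
      using I[OF indicator_mult_L2[OF gh(1)], of "{0<..<y}"] I[OF indicator_mult_L2[OF gh(2)], of "{0<..<y}"]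
      by (simp add: right_diff_distrib)
    then show "(\<integral>t. indicator {0<..<y} t * (g t - h t) \<partial>unit_int) = 0"
      using weak_derivative_FTC[OF assms(1,2), of 0 y] weak_derivative_FTC[OF assms(1,3), of 0 y] y by simp
  qed
  then show ?thesis by simp
qed

lemma integral_indicator_Ioo_unit_int:
  assumes "0 \<le> x" "x \<le> y" "y \<le> 1"
  shows "(\<integral>t. indicat_real {x<..<y} t \<partial>unit_int) = y - x"
proof -
  have "(\<integral>t. indicat_real {x<..<y} t \<partial>unit_int)
      = (\<integral>t. indicat_real {0<..<1} t *\<^sub>R indicat_real {x<..<y} t \<partial>lebesgue)"
    by (rule integral_restrict_space) simp
  also have "\<dots> = (\<integral>t. indicat_real {x<..<y} t \<partial>lebesgue)"
    by (rule Bochner_Integration.integral_cong) (use assms in \<open>auto simp: indicator_def\<close>)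
  finally show ?thesis using assms by simp
qed

text \<open>Cauchy-Schwarz for \<open>g\<close> against the indicator of \<open>(x, y)\<close>. This
  gives the equicontinuity of minimising sequences and, with \<open>x = 0\<close>, the sup
  bound.\<close>

lemma weak_derivative_Hoelder:
  assumes K: "continuous_on {0..1} K" and g: "has_weak_derivative K g"
    and xy: "0 \<le> x" "x \<le> y" "y \<le> 1"
  shows "(K y - K x)\<^sup>2 \<le> (y - x) * (\<integral>t. (g t)\<^sup>2 \<partial>unit_int)"
proof (cases "x = y")
  case False
  with xy have "x < y" by simp
  have g2: "L2 unit_int g" using g by (simp add: has_weak_derivative_iff)
  have ind: "L2 unit_int (indicat_real {x<..<y})"
    using indicator_mult_L2[OF L2_const[OF finite_measure_unit_int, of 1], of "{x<..<y}"] by simp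
  have "(indicat_real {x<..<y} t)\<^sup>2 = indicat_real {x<..<y} t" for t
    by (simp add: indicator_def)
  then have "(\<integral>t. (indicat_real {x<..<y} t)\<^sup>2 \<partial>unit_int) = y - x"
    using integral_indicator_Ioo_unit_int[OF xy] by simp
  then show ?thesis
    using L2_Cauchy_Schwarz[OF ind g2] weak_derivative_FTC[OF K g xy(1) \<open>x < y\<close> xy(3)] by simp
qed simp

section \<open>The energy and its minimisers\<close>

lemma abs_sin_diff_le: "\<bar>sin x - sin y\<bar> \<le> \<bar>x - y\<bar>" for x y :: real
proof -
  have "\<bar>sin ((x - y) / 2)\<bar> * \<bar>cos ((x + y) / 2)\<bar> \<le> \<bar>(x - y) / 2\<bar> * 1"
    by (intro mult_mono abs_sin_x_le_abs_x abs_cos_le_one) auto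
  then show ?thesis by (simp add: sin_diff_sin abs_mult)
qed

text \<open>The mean value theorem gives \<open>sin x = x * cos z\<close> with
  \<open>z < 1 < pi / 3\<close>, where the cosine is at least 1/2. It bounds the load on the trial
  state from below.\<close>

lemma half_le_sin:
  fixes x :: real
  assumes "0 \<le> x" "x \<le> 1"
  shows "x / 2 \<le> sin x"
proof (cases "x = 0")
  case False
  with assms have "0 < x" by simp
  have "\<exists>z>0. z < x \<and> sin x - sin 0 = (x - 0) * cos z"
    by (rule MVT2[OF \<open>0 < x\<close>]) (rule DERIV_sin)
  then obtain z where z: "0 < z" "z < x" "sin x = x * cos z" by auto
  have "cos (pi / 3) \<le> cos z"
    using z assms pi_gt3 by (intro cos_monotone_0_pi_le) auto
  then have "x * (1 / 2) \<le> x * cos z"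
    using \<open>0 < x\<close> by (simp add: cos_60)
  then show ?thesis using z by simp
qed simp

text \<open>\<open>unit_int\<close> has total mass 1, so a pointwise bound passes to the integral
  unchanged.\<close>

lemma abs_integral_unit_int_le:
  assumes "integrable unit_int f" "\<And>t. t \<in> {0<..<1} \<Longrightarrow> \<bar>f t\<bar> \<le> (e::real)"
  shows "\<bar>\<integral>t. f t \<partial>unit_int\<bar> \<le> e"
proof -
  interpret finite_measure unit_int by (rule finite_measure_unit_int)
  have "\<bar>\<integral>t. f t \<partial>unit_int\<bar> \<le> (\<integral>t. \<bar>f t\<bar> \<partial>unit_int)"
    using integral_norm_bound[of unit_int f] by simp
  also have "\<dots> \<le> (\<integral>t. e \<partial>unit_int)"
    using assms by (intro integral_mono) auto
  finally show ?thesis by (simp only: integral_unit_int_const)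
qed

definition potential :: "(real \<Rightarrow> real) \<Rightarrow> real" where
  "potential K = (\<integral>t. (1 - t) * sin (K t) \<partial>unit_int)"

lemma load_integrable:
  assumes "continuous_on {0..1} K"
  shows "integrable unit_int (\<lambda>t. (1 - t) * sin (K t))"
    "integrable unit_int (\<lambda>t. (1 - t) * \<bar>sin (K t)\<bar>)"
  by (intro L2_integrable finite_measure_unit_int continuous_L2 continuous_intros assms)+

lemma abs_potential_le_1:
  assumes "continuous_on {0..1} K"
  shows "\<bar>potential K\<bar> \<le> 1"
  unfolding potential_def
proof (rule abs_integral_unit_int_le[OF load_integrable(1)[OF assms]])
  fix t :: real assume t: "t \<in> {0<..<1}"
  have "\<bar>1 - t\<bar> * \<bar>sin (K t)\<bar> \<le> 1 * 1"
    using t by (intro mult_mono) auto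
  then show "\<bar>(1 - t) * sin (K t)\<bar> \<le> 1" by (simp add: abs_mult)
qed

text \<open>The sine is 1-Lipschitz and the weight \<open>1 - t\<close> is at most 1.\<close>

lemma potential_Lipschitz:
  assumes K: "continuous_on {0..1} K" and L: "continuous_on {0..1} L"
    and le: "\<And>t. t \<in> {0<..<1} \<Longrightarrow> \<bar>K t - L t\<bar> \<le> e"
  shows "\<bar>potential K - potential L\<bar> \<le> e"
proof -
  have "\<bar>\<integral>t. (1 - t) * sin (K t) - (1 - t) * sin (L t) \<partial>unit_int\<bar> \<le> e"
  proof (rule abs_integral_unit_int_le)
    show "integrable unit_int (\<lambda>t. (1 - t) * sin (K t) - (1 - t) * sin (L t))"
      using load_integrable(1) K L by (intro Bochner_Integration.integrable_diff) auto
    fix t :: real assume t: "t \<in> {0<..<1}"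
    have "\<bar>1 - t\<bar> * \<bar>sin (K t) - sin (L t)\<bar> \<le> 1 * e"
      using t le[OF t] abs_sin_diff_le[of "K t" "L t"] by (intro mult_mono) auto
    then show "\<bar>(1 - t) * sin (K t) - (1 - t) * sin (L t)\<bar> \<le> e"
      by (simp add: abs_mult[symmetric] right_diff_distrib)
  qed
  then show ?thesis
    using load_integrable(1)[OF K] load_integrable(1)[OF L] by (simp add: potential_def)
qed

lemma W12_lI:
  assumes "continuous_on {0..1} K" "K 0 = 0" "has_weak_derivative K g"
  shows "K \<in> W12_l"
  using assms continuous_L2[of K] by (auto simp: W12_l_def W12_def square_integrable_iff_L2)

lemma W12_lE:
  assumes "K \<in> W12_l"
  obtains g where "continuous_on {0..1} K" "K 0 = 0" "has_weak_derivative K g"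
  using assms by (auto simp: W12_l_def W12_def)

lemma zero_W12_l: "(\<lambda>t. 0) \<in> W12_l" "has_weak_derivative (\<lambda>t. 0) (\<lambda>t. 0)"
  using has_weak_derivative_C1[of "\<lambda>t. 0" "\<lambda>t. 0"] by (auto intro: W12_lI)

text \<open>\<open>\<beta>\<close> may differ from the cross-section mean on a null set: \<open>design_I V a b\<close> and hence its mean
  vanish at \<open>x1 = V\<close>.\<close>

locale rod =
  fixes B :: "real \<times> real \<Rightarrow> real" and \<beta> :: "real \<Rightarrow> real" and \<alpha> M :: real
  assumes \<alpha>: "0 < \<alpha>" and \<beta>_bounds: "\<And>t. \<alpha> \<le> \<beta> t" "\<And>t. \<beta> t \<le> M"
    and \<beta>_measurable [measurable]: "\<beta> \<in> borel_measurable unit_int"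
    and mean_measurable [measurable]: "cross_section_mean B \<in> borel_measurable unit_int"
    and mean_eq: "AE t in unit_int. cross_section_mean B t = \<beta> t"
begin

section \<open>Coercivity and convexity of the energy\<close>

lemma \<beta>_nonneg: "0 \<le> \<beta> t"
  using \<alpha> \<beta>_bounds(1)[of t] by linarith

lemma \<beta>_mult_L2: "L2 unit_int g \<Longrightarrow> L2 unit_int (\<lambda>t. \<beta> t * g t)"
proof (rule L2_bounded_mult[where C = M])
  show "\<bar>\<beta> t\<bar> \<le> M" for t using \<beta>_bounds(2)[of t] \<beta>_nonneg[of t] by simp
qed simp_all

lemma \<beta>_integrable:
  assumes "L2 unit_int g" "L2 unit_int h"
  shows "integrable unit_int (\<lambda>t. \<beta> t * g t * h t)"
  using L2_integrable_mult[OF \<beta>_mult_L2[OF assms(1)] assms(2)] .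

lemma \<beta>_integral_ge:
  assumes "L2 unit_int g"
  shows "\<alpha> * (\<integral>t. (g t)\<^sup>2 \<partial>unit_int) \<le> (\<integral>t. \<beta> t * (g t)\<^sup>2 \<partial>unit_int)"
proof -
  have "(\<integral>t. \<alpha> * (g t)\<^sup>2 \<partial>unit_int) \<le> (\<integral>t. \<beta> t * (g t)\<^sup>2 \<partial>unit_int)"
    using assms \<beta>_integrable[OF assms assms] \<beta>_bounds(1)
    by (intro integral_mono) (auto simp: L2_def power2_eq_square mult.assoc intro!: mult_right_mono)
  then show ?thesis by simp
qed

text \<open>\<open>energy\<close> involves a chosen weak derivative and the actual cross-section
  mean; replacing them by \<open>g\<close> and \<open>\<beta>\<close> changes the integrand on a
  null set only.\<close>

lemma energy_eq:
  assumes "K \<in> W12_l" "has_weak_derivative K g"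
  shows "energy B K = 1/2 * (\<integral>t. \<beta> t * (g t)\<^sup>2 \<partial>unit_int) + potential K"
proof -
  have wd: "has_weak_derivative K (weak_derivative K)"
    unfolding weak_derivative_def by (rule someI[of "has_weak_derivative K", OF assms(2)])
  have [measurable]: "g \<in> borel_measurable unit_int" "weak_derivative K \<in> borel_measurable unit_int"
    using wd assms(2) by (auto simp: has_weak_derivative_iff L2_def)
  have "continuous_on {0..1} K" using assms(1) by (rule W12_lE)
  from weak_derivative_unique[OF this wd assms(2)]
  have "AE t in unit_int. weak_derivative K t = g t" .
  with mean_eq have "AE t in unit_int. cross_section_mean B t * (weak_derivative K t)\<^sup>2 = \<beta> t * (g t)\<^sup>2"
    by eventually_elim simp
  then have "(\<integral>t. cross_section_mean B t * (weak_derivative K t)\<^sup>2 \<partial>unit_int)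
      = (\<integral>t. \<beta> t * (g t)\<^sup>2 \<partial>unit_int)"
    by (intro integral_cong_AE) simp_all
  then show ?thesis by (simp add: energy_def set_integral_unit_int potential_def)
qed

text \<open>Coercivity: the load term is at least -1, so all energy beyond that is bending
  energy.\<close>

lemma L2_norm_le_energy:
  assumes "K \<in> W12_l" "has_weak_derivative K g"
  shows "\<alpha> * (\<integral>t. (g t)\<^sup>2 \<partial>unit_int) \<le> 2 * (energy B K + 1)"
proof -
  have "continuous_on {0..1} K" using assms(1) by (rule W12_lE)
  from abs_potential_le_1[OF this] have "- 1 \<le> potential K" by simp
  moreover have "L2 unit_int g" using assms(2) by (simp add: has_weak_derivative_iff)
  ultimately show ?thesis using \<beta>_integral_ge[of g] energy_eq[OF assms] by simp
qed

lemma potential_le_energy: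
  assumes "K \<in> W12_l"
  shows "potential K \<le> energy B K"
proof -
  obtain g where "has_weak_derivative K g" using assms by (rule W12_lE)
  moreover have "0 \<le> (\<integral>t. \<beta> t * (g t)\<^sup>2 \<partial>unit_int)"
    using \<beta>_nonneg by simp
  ultimately show ?thesis using energy_eq[OF assms] by simp
qed

lemma energy_ge:
  assumes "K \<in> W12_l"
  shows "- 1 \<le> energy B K"
proof -
  have "continuous_on {0..1} K" using assms by (rule W12_lE)
  from abs_potential_le_1[OF this] potential_le_energy[OF assms] show ?thesis by simp
qed

lemma energy_zero: "energy B (\<lambda>t. 0) = 0"
  using energy_eq[OF zero_W12_l] by (simp add: potential_def)

text \<open>Along a minimising sequence that converges uniformly the right-hand side tends to 0, so the
  weak derivatives are Cauchy in \<open>L\<^sup>2\<close> and no weak compactness is needed.\<close>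

lemma energy_midpoint:
  assumes K: "K \<in> W12_l" "has_weak_derivative K g" and L: "L \<in> W12_l" "has_weak_derivative L h"
    and lower: "\<And>J. J \<in> W12_l \<Longrightarrow> m \<le> energy B J"
    and close: "\<And>t. t \<in> {0<..<1} \<Longrightarrow> \<bar>K t - L t\<bar> \<le> e"
  shows "\<alpha> / 8 * (\<integral>t. (g t - h t)\<^sup>2 \<partial>unit_int) \<le> (energy B K + energy B L) / 2 - m + e / 2"
proof -
  have cK: "continuous_on {0..1} K" "K 0 = 0" using K(1) by (auto elim: W12_lE)
  have cL: "continuous_on {0..1} L" "L 0 = 0" using L(1) by (auto elim: W12_lE)
  have gh: "L2 unit_int g" "L2 unit_int h" using K L by (auto simp: has_weak_derivative_iff)
  define P where "P t = 1/2 * K t + 1/2 * L t" for t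
  define p where "p t = 1/2 * g t + 1/2 * h t" for t
  have cP: "continuous_on {0..1} P"
    unfolding P_def by (intro continuous_intros cK cL)
  have wP: "has_weak_derivative P p"
    unfolding P_def[abs_def] p_def[abs_def]
    by (intro has_weak_derivative_combine continuous_L2 cK cL K L)
  have PW: "P \<in> W12_l" by (rule W12_lI[OF cP _ wP]) (simp add: P_def cK cL)
  have P_close: "\<bar>P t - K t\<bar> \<le> e / 2" "\<bar>P t - L t\<bar> \<le> e / 2" if "t \<in> {0<..<1}" for t
  proof -
    have "P t - K t = (L t - K t) / 2" "P t - L t = (K t - L t) / 2" by (simp_all add: P_def field_simps)
    then show "\<bar>P t - K t\<bar> \<le> e / 2" "\<bar>P t - L t\<bar> \<le> e / 2"
      using close[OF that] by (simp_all only: abs_divide) (simp_all add: abs_minus_commute)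
  qed
  have pot: "\<bar>potential P - potential K\<bar> \<le> e / 2" "\<bar>potential P - potential L\<bar> \<le> e / 2"
    by (rule potential_Lipschitz[OF cP cK(1) P_close(1)], assumption)
      (rule potential_Lipschitz[OF cP cL(1) P_close(2)], assumption)
  note [simp] = \<beta>_integrable[OF gh(1) gh(1)] \<beta>_integrable[OF gh(2) gh(2)] \<beta>_integrable[OF gh(1) gh(2)]
  have sq: "\<beta> t * (u t)\<^sup>2 = \<beta> t * u t * u t" for u t by (simp add: power2_eq_square)
  have "(\<integral>t. \<beta> t * (p t)\<^sup>2 \<partial>unit_int)
      = (\<integral>t. 1/4 * (\<beta> t * g t * g t) + 1/2 * (\<beta> t * g t * h t) + 1/4 * (\<beta> t * h t * h t) \<partial>unit_int)"
    by (rule Bochner_Integration.integral_cong) (auto simp: p_def power2_eq_square algebra_simps)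
  also have "\<dots> = 1/4 * (\<integral>t. \<beta> t * g t * g t \<partial>unit_int) + 1/2 * (\<integral>t. \<beta> t * g t * h t \<partial>unit_int)
      + 1/4 * (\<integral>t. \<beta> t * h t * h t \<partial>unit_int)"
    by simp
  finally have 1: "(\<integral>t. \<beta> t * (p t)\<^sup>2 \<partial>unit_int) = \<dots>" .
  have "(\<integral>t. \<beta> t * (g t - h t)\<^sup>2 \<partial>unit_int)
      = (\<integral>t. \<beta> t * g t * g t + (-2) * (\<beta> t * g t * h t) + \<beta> t * h t * h t \<partial>unit_int)"
    by (rule Bochner_Integration.integral_cong) (auto simp: power2_eq_square algebra_simps)
  also have "\<dots> = (\<integral>t. \<beta> t * g t * g t \<partial>unit_int) + (-2) * (\<integral>t. \<beta> t * g t * h t \<partial>unit_int)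
      + (\<integral>t. \<beta> t * h t * h t \<partial>unit_int)"
    by (simp del: mult_minus_left)
  finally have 2: "(\<integral>t. \<beta> t * (g t - h t)\<^sup>2 \<partial>unit_int) = \<dots>" .
  have parallelogram: "(\<integral>t. \<beta> t * (g t - h t)\<^sup>2 \<partial>unit_int) + 4 * (\<integral>t. \<beta> t * (p t)\<^sup>2 \<partial>unit_int)
      = 2 * (\<integral>t. \<beta> t * (g t)\<^sup>2 \<partial>unit_int) + 2 * (\<integral>t. \<beta> t * (h t)\<^sup>2 \<partial>unit_int)"
    unfolding 1 2 by (simp add: sq)
  have "potential P - potential K \<le> e / 2" "potential P - potential L \<le> e / 2"
    using pot by (auto simp only: abs_le_iff)
  \<comment> \<open>The claim is one eighth of the parallelogram identity. Each half bending
    integral is an energy minus a potential, the energy of the midpoint \<open>P\<close> is at least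
    \<open>m\<close>, and the average of the two potential estimates contributes
    \<open>e / 2\<close>.\<close>
  then show ?thesis
    using parallelogram lower[OF PW] energy_eq[OF PW wP] energy_eq[OF K] energy_eq[OF L]
      \<beta>_integral_ge[OF L2_diff[OF gh]]
    by (simp add: field_simps)
qed

section \<open>Existence of a minimiser\<close>

lemma energy_minimiser_exists:
  obtains K where "K \<in> W12_l" "\<And>L. L \<in> W12_l \<Longrightarrow> energy B K \<le> energy B L"
proof -
  define m where "m = Inf (energy B ` W12_l)"
  have ne: "energy B ` W12_l \<noteq> {}" using zero_W12_l by blast
  have bdd: "bdd_below (energy B ` W12_l)" using energy_ge by (auto intro!: bdd_belowI[of _ "-1"])
  have lower: "m \<le> energy B J" if "J \<in> W12_l" for J
    unfolding m_def using that by (intro cInf_lower bdd) auto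
  have "\<exists>K g. K \<in> W12_l \<and> has_weak_derivative K g \<and> energy B K < m + inverse (real (Suc n))" for n
  proof -
    have "\<exists>x\<in>energy B ` W12_l. x < m + inverse (real (Suc n))"
      by (rule cInf_lessD[OF ne]) (simp add: m_def)
    then show ?thesis by (blast elim: W12_lE)
  qed
  then obtain K g where K: "\<And>n. K n \<in> W12_l" "\<And>n. has_weak_derivative (K n) (g n)"
    and E: "\<And>n. energy B (K n) < m + inverse (real (Suc n))" by metis
  have cK: "continuous_on {0..1} (K n)" "K n 0 = 0" for n using K(1)[of n] by (auto elim: W12_lE)
  \<comment> \<open>\<open>L2_norm_le_energy\<close> evaluated at the energy bound
    \<open>m + 1\<close>, valid along the whole sequence.\<close>
  define G where "G = 2 * (m + 2) / \<alpha>"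
  have G: "(\<integral>t. (g n t)\<^sup>2 \<partial>unit_int) \<le> G" for n
  proof -
    have "inverse (real (Suc n)) \<le> 1" by (simp add: field_simps)
    then have "energy B (K n) \<le> m + 1"
      using E[of n] by (meson add_left_mono less_imp_le order_trans)
    then have "2 * (energy B (K n) + 1) \<le> 2 * (m + 2)" by simp
    with L2_norm_le_energy[OF K, of n] have "\<alpha> * (\<integral>t. (g n t)\<^sup>2 \<partial>unit_int) \<le> 2 * (m + 2)"
      by (rule order_trans)
    then show ?thesis using \<alpha> by (simp add: G_def field_simps)
  qed
  have "0 \<le> G" using G[of 0] by (rule order_trans[rotated]) simp
  have Hoelder: "(K n x - K n y)\<^sup>2 \<le> \<bar>x - y\<bar> * G" if "x \<in> {0..1}" "y \<in> {0..1}" for n x y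
  proof (cases "x \<le> y")
    case True
    then have "(K n y - K n x)\<^sup>2 \<le> (y - x) * (\<integral>t. (g n t)\<^sup>2 \<partial>unit_int)"
      using weak_derivative_Hoelder[OF cK(1) K(2)] that by auto
    also have "\<dots> \<le> (y - x) * G" using True G by (intro mult_left_mono) auto
    finally show ?thesis using True by (simp add: power2_commute)
  next
    case False
    then have "(K n x - K n y)\<^sup>2 \<le> (x - y) * (\<integral>t. (g n t)\<^sup>2 \<partial>unit_int)"
      using weak_derivative_Hoelder[OF cK(1) K(2)] that by auto
    also have "\<dots> \<le> (x - y) * G" using False G by (intro mult_left_mono) auto
    finally show ?thesis using False by simp
  qed
  have bound: "norm (K n x) \<le> sqrt G" if "x \<in> {0..1}" for n x
  proof (rule real_le_rsqrt)
    have "(K n x)\<^sup>2 \<le> x * G" using Hoelder[OF that, of 0] that cK(2) by simp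
    also have "\<dots> \<le> 1 * G" using that \<open>0 \<le> G\<close> by (intro mult_right_mono) auto
    finally show "(norm (K n x))\<^sup>2 \<le> G" by simp
  qed
  have equi: "\<exists>d>0. \<forall>n y. y \<in> {0..1} \<and> norm (x - y) < d \<longrightarrow> norm (K n x - K n y) < e"
    if "x \<in> {0..1}" "0 < e" for x e
  \<comment> \<open>The modulus solves \<open>\<bar>x - y\<bar> * G < e\<^sup>2\<close>; the
    \<open>+ 1\<close> covers \<open>G = 0\<close>.\<close>
  proof (intro exI[of _ "e\<^sup>2 / (G + 1)"] conjI allI impI)
    show "0 < e\<^sup>2 / (G + 1)" using that \<open>0 \<le> G\<close> by simp
    fix n y assume y: "y \<in> {0..1} \<and> norm (x - y) < e\<^sup>2 / (G + 1)"
    then have "\<bar>x - y\<bar> * (G + 1) < e\<^sup>2" using \<open>0 \<le> G\<close> by (simp add: pos_less_divide_eq)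
    moreover have "\<bar>x - y\<bar> * G \<le> \<bar>x - y\<bar> * (G + 1)" by (intro mult_left_mono) auto
    ultimately have "(norm (K n x - K n y))\<^sup>2 < e\<^sup>2" using Hoelder[of x y n] that y by simp
    then show "norm (K n x - K n y) < e"
      by (rule power_less_imp_less_base) (use that in simp)
  qed
  obtain L and k :: "nat \<Rightarrow> nat" where cL: "continuous_on {0..1} L" and k: "strict_mono k"
    and unif: "\<And>e. 0 < e \<Longrightarrow> \<exists>N. \<forall>n x. n \<ge> N \<and> x \<in> {0..1} \<longrightarrow> norm (K (k n) x - L x) < e"
    using Arzela_Ascoli[OF compact_Icc bound equi] by metis
  have g2: "L2 unit_int (g n)" for n using K(2) by (simp add: has_weak_derivative_iff)
  have E_lim: "(\<lambda>n. energy B (K (k n))) \<longlonglongrightarrow> m"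
  proof (rule tendsto_sandwich[OF _ _ tendsto_const])
    show "\<forall>\<^sub>F n in sequentially. m \<le> energy B (K (k n))" using lower K(1) by simp
    have "energy B (K (k n)) \<le> m + inverse (real (Suc n))" for n
    proof -
      have "inverse (real (Suc (k n))) \<le> inverse (real (Suc n))"
        using seq_suble[OF k, of n] by (intro le_imp_inverse_le) auto
      then show ?thesis using E[of "k n"] by linarith
    qed
    then show "\<forall>\<^sub>F n in sequentially. energy B (K (k n)) \<le> m + inverse (real (Suc n))" by simp
    show "(\<lambda>n. m + inverse (real (Suc n))) \<longlonglongrightarrow> m"
      using tendsto_add[OF tendsto_const[of m] LIMSEQ_inverse_real_of_nat] by simp
  qed
  have "\<exists>N. \<forall>i\<ge>N. \<forall>j\<ge>N. (\<integral>t. (g (k i) t - g (k j) t)\<^sup>2 \<partial>unit_int) < r" if "0 < r" for r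
  proof -
    \<comment> \<open>Chosen so that \<open>energy_midpoint\<close>, at distance
      \<open>2 * e\<close> and with energies below \<open>m + e\<close>, yields the bound
      \<open>2 * e = \<alpha> / 8 * (r / 2)\<close>.\<close>
    define e where "e = \<alpha> * r / 32"
    have "0 < e" using \<alpha> that by (simp add: e_def)
    obtain N1 where N1: "\<And>n x. n \<ge> N1 \<Longrightarrow> x \<in> {0..1} \<Longrightarrow> norm (K (k n) x - L x) < e"
      using unif[OF \<open>0 < e\<close>] by blast
    have "\<forall>\<^sub>F n in sequentially. energy B (K (k n)) < m + e"
      using order_tendstoD(2)[OF E_lim, of "m + e"] \<open>0 < e\<close> by simp
    then obtain N2 where N2: "\<And>n. n \<ge> N2 \<Longrightarrow> energy B (K (k n)) < m + e"
      by (auto simp: eventually_sequentially)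
    have "(\<integral>t. (g (k i) t - g (k j) t)\<^sup>2 \<partial>unit_int) < r" if ij: "i \<ge> max N1 N2" "j \<ge> max N1 N2" for i j
    proof -
      have "\<bar>K (k i) t - K (k j) t\<bar> \<le> 2 * e" if "t \<in> {0<..<1}" for t
        using N1[of i t] N1[of j t] ij that by (simp add: abs_le_iff abs_less_iff)
      from energy_midpoint[OF K K lower this]
      have "\<alpha> / 8 * (\<integral>t. (g (k i) t - g (k j) t)\<^sup>2 \<partial>unit_int)
          \<le> (energy B (K (k i)) + energy B (K (k j))) / 2 - m + (2 * e) / 2" by blast
      also have "\<dots> < 2 * e" using N2[of i] N2[of j] ij by (simp add: field_simps)
      also have "\<dots> = \<alpha> / 8 * (r / 2)" by (simp add: e_def)
      finally have "(\<integral>t. (g (k i) t - g (k j) t)\<^sup>2 \<partial>unit_int) < r / 2" using \<alpha> by simp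
      then show ?thesis using \<open>0 < r\<close> by simp
    qed
    then show ?thesis by blast
  qed
  from L2_complete[OF finite_measure_unit_int g2 this]
  obtain h where h: "L2 unit_int h" "(\<lambda>n. \<integral>t. (g (k n) t - h t)\<^sup>2 \<partial>unit_int) \<longlonglongrightarrow> 0" by blast
  have K_lim: "(\<lambda>n. \<integral>t. (K (k n) t - L t)\<^sup>2 \<partial>unit_int) \<longlonglongrightarrow> 0"
  proof (rule LIMSEQ_I)
    fix r :: real assume "0 < r"
    then obtain N where N: "\<And>n x. n \<ge> N \<Longrightarrow> x \<in> {0..1} \<Longrightarrow> norm (K (k n) x - L x) < sqrt (r / 2)"
      using unif[of "sqrt (r / 2)"] by auto
    have "\<bar>\<integral>t. (K (k n) t - L t)\<^sup>2 \<partial>unit_int\<bar> \<le> r / 2" if "n \<ge> N" for n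
    proof (rule abs_integral_unit_int_le)
      show "integrable unit_int (\<lambda>t. (K (k n) t - L t)\<^sup>2)"
        by (intro L2_integrable_power2 continuous_L2 continuous_intros cK cL)
      fix t :: real assume "t \<in> {0<..<1}"
      then have "\<bar>K (k n) t - L t\<bar> \<le> sqrt (r / 2)" using N[OF that, of t] by simp
      then have "\<bar>K (k n) t - L t\<bar>\<^sup>2 \<le> (sqrt (r / 2))\<^sup>2" by (intro power_mono) auto
      then show "\<bar>(K (k n) t - L t)\<^sup>2\<bar> \<le> r / 2" using \<open>0 < r\<close> by simp
    qed
    then show "\<exists>no. \<forall>n\<ge>no. norm ((\<integral>t. (K (k n) t - L t)\<^sup>2 \<partial>unit_int) - 0) < r"
      using \<open>0 < r\<close> by (intro exI[of _ N]) fastforce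
  qed
  have wL: "has_weak_derivative L h"
    by (rule has_weak_derivative_limit[OF K(2) continuous_L2[OF cK(1)] continuous_L2[OF cL] h(1) K_lim h(2)])
  have "L 0 = 0"
  proof (rule ccontr)
    assume "L 0 \<noteq> 0"
    then obtain N where "\<forall>n x. n \<ge> N \<and> x \<in> {0..1} \<longrightarrow> norm (K (k n) x - L x) < \<bar>L 0\<bar>"
      using unif[of "\<bar>L 0\<bar>"] by auto
    then have "norm (K (k N) 0 - L 0) < \<bar>L 0\<bar>" by auto
    then show False by (simp add: cK)
  qed
  then have LW: "L \<in> W12_l" using W12_lI[OF cL _ wL] by simp
  have pot_lim: "(\<lambda>n. potential (K (k n))) \<longlonglongrightarrow> potential L"
  proof (rule LIMSEQ_I)
    fix r :: real assume "0 < r"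
    then obtain N where N: "\<And>n x. n \<ge> N \<Longrightarrow> x \<in> {0..1} \<Longrightarrow> norm (K (k n) x - L x) < r / 2"
      using unif[of "r / 2"] by auto
    have "\<bar>potential (K (k n)) - potential L\<bar> \<le> r / 2" if "n \<ge> N" for n
      using N[OF that] by (intro potential_Lipschitz cK cL) (auto intro: less_imp_le)
    then show "\<exists>no. \<forall>n\<ge>no. norm (potential (K (k n)) - potential L) < r"
      using \<open>0 < r\<close> by (intro exI[of _ N]) fastforce
  qed
  have inner_lim: "(\<lambda>n. \<integral>t. \<beta> t * h t * g (k n) t \<partial>unit_int) \<longlonglongrightarrow> (\<integral>t. \<beta> t * h t * h t \<partial>unit_int)"
    by (rule L2_tendsto_inner[OF g2 h(1) \<beta>_mult_L2[OF h(1)] h(2)])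
  \<comment> \<open>Convexity: the bending energy lies above its tangent at \<open>h\<close>.\<close>
  have below: "(\<integral>t. \<beta> t * h t * g (k n) t \<partial>unit_int) - 1/2 * (\<integral>t. \<beta> t * h t * h t \<partial>unit_int)
      + potential (K (k n)) \<le> energy B (K (k n))" for n
  proof -
    note [simp] = \<beta>_integrable[OF h(1) h(1)] \<beta>_integrable[OF h(1) g2] \<beta>_integrable[OF g2 g2]
    have "0 \<le> (\<integral>t. \<beta> t * (g (k n) t - h t)\<^sup>2 \<partial>unit_int)" using \<beta>_nonneg by simp
    also have "\<dots> = (\<integral>t. \<beta> t * (g (k n) t)\<^sup>2 + (-2) * (\<beta> t * h t * g (k n) t) + \<beta> t * h t * h t \<partial>unit_int)"
      by (rule Bochner_Integration.integral_cong) (auto simp: power2_eq_square algebra_simps)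
    also have "\<dots> = (\<integral>t. \<beta> t * (g (k n) t)\<^sup>2 \<partial>unit_int)
        + (-2) * (\<integral>t. \<beta> t * h t * g (k n) t \<partial>unit_int) + (\<integral>t. \<beta> t * h t * h t \<partial>unit_int)"
    proof -
      have "integrable unit_int (\<lambda>t. \<beta> t * (g (k n) t)\<^sup>2)"
        using \<beta>_integrable[OF g2 g2, of "k n" "k n"] by (simp add: power2_eq_square mult.assoc)
      then show ?thesis by (simp del: mult_minus_left)
    qed
    finally show ?thesis
      using energy_eq[OF K, of "k n"] by simp
  qed
  \<comment> \<open>In the limit the tangent at \<open>h\<close> is evaluated at \<open>h\<close>
    itself, so the limit is \<open>energy B L\<close>.\<close>
  have "(\<lambda>n. (\<integral>t. \<beta> t * h t * g (k n) t \<partial>unit_int) - 1/2 * (\<integral>t. \<beta> t * h t * h t \<partial>unit_int)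
      + potential (K (k n)))
    \<longlonglongrightarrow> (\<integral>t. \<beta> t * h t * h t \<partial>unit_int) - 1/2 * (\<integral>t. \<beta> t * h t * h t \<partial>unit_int) + potential L"
    by (intro tendsto_add tendsto_diff inner_lim pot_lim tendsto_const)
  from LIMSEQ_le[OF this E_lim]
  have "(\<integral>t. \<beta> t * h t * h t \<partial>unit_int) - 1/2 * (\<integral>t. \<beta> t * h t * h t \<partial>unit_int) + potential L \<le> m"
    using below by blast
  then have "energy B L \<le> m"
    using energy_eq[OF LW wL] by (simp add: power2_eq_square mult.assoc[symmetric])
  then show ?thesis using lower LW by (intro that[of L]) force+
qed

section \<open>Bounds on the compliance from comparison states\<close>

lemma rod_state_minimises:
  shows "rod_state B \<in> W12_l" "L \<in> W12_l \<Longrightarrow> energy B (rod_state B) \<le> energy B L"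
proof -
  obtain K where "K \<in> W12_l" "\<And>L. L \<in> W12_l \<Longrightarrow> energy B K \<le> energy B L"
    using energy_minimiser_exists by blast
  then have "is_arg_min (energy B) (\<lambda>K. K \<in> W12_l) K"
    by (auto simp: is_arg_min_def not_less)
  then have "is_arg_min (energy B) (\<lambda>K. K \<in> W12_l) (rod_state B)"
    unfolding rod_state_def arg_min_def by (rule someI[of "is_arg_min (energy B) (\<lambda>K. K \<in> W12_l)"])
  then show "rod_state B \<in> W12_l" "L \<in> W12_l \<Longrightarrow> energy B (rod_state B) \<le> energy B L"
    by (auto simp: is_arg_min_def not_less)
qed

lemma compliance_eq: "compliance B = (\<integral>t. (1 - t) * \<bar>sin (rod_state B t)\<bar> \<partial>unit_int)"
  by (simp add: compliance_def set_integral_unit_int)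

text \<open>Comparison with the zero state leaves a bending energy of at most 1, the bound for the
  load term; hence the squared L2 norm of the weak derivative is at most
  \<open>2 / \<alpha>\<close>. The Hoelder bound from \<open>K 0 = 0\<close> and
  \<open>\<bar>sin x\<bar> \<le> \<bar>x\<bar>\<close> do the rest.\<close>

lemma compliance_upper: "compliance B \<le> sqrt (2 / \<alpha>)"
proof -
  obtain g where K: "continuous_on {0..1} (rod_state B)" "rod_state B 0 = 0" "has_weak_derivative (rod_state B) g"
    using rod_state_minimises(1) by (rule W12_lE)
  have "energy B (rod_state B) \<le> 0"
    using rod_state_minimises(2)[OF zero_W12_l(1)] energy_zero by simp
  then have "\<alpha> * (\<integral>t. (g t)\<^sup>2 \<partial>unit_int) \<le> 2"
    using L2_norm_le_energy[OF rod_state_minimises(1) K(3)] by simp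
  then have g: "(\<integral>t. (g t)\<^sup>2 \<partial>unit_int) \<le> 2 / \<alpha>"
    using \<alpha> by (simp add: field_simps)
  have "\<bar>\<integral>t. (1 - t) * \<bar>sin (rod_state B t)\<bar> \<partial>unit_int\<bar> \<le> sqrt (2 / \<alpha>)"
  proof (rule abs_integral_unit_int_le[OF load_integrable(2)[OF K(1)]])
    fix t :: real assume t: "t \<in> {0<..<1}"
    have "(rod_state B t)\<^sup>2 \<le> t * (\<integral>t. (g t)\<^sup>2 \<partial>unit_int)"
      using weak_derivative_Hoelder[OF K(1,3), of 0 t] t K(2) by simp
    also have "\<dots> \<le> 1 * (2 / \<alpha>)" using t g by (intro mult_mono) auto
    finally have "\<bar>rod_state B t\<bar> \<le> sqrt (2 / \<alpha>)" by (intro real_le_rsqrt) simp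
    moreover have "\<bar>1 - t\<bar> * \<bar>sin (rod_state B t)\<bar> \<le> 1 * \<bar>rod_state B t\<bar>"
      using t abs_sin_diff_le[of "rod_state B t" 0] by (intro mult_mono) auto
    ultimately show "\<bar>(1 - t) * \<bar>sin (rod_state B t)\<bar>\<bar> \<le> sqrt (2 / \<alpha>)" by (simp add: abs_mult)
  qed
  then show ?thesis by (simp add: compliance_eq)
qed

text \<open>Since \<open>- sin x \<le> \<bar>sin x\<bar>\<close>, the compliance is at least minus
  the load term of the state, and the bending term is nonnegative.\<close>

lemma compliance_lower:
  assumes "L \<in> W12_l"
  shows "- energy B L \<le> compliance B"
proof -
  have K: "continuous_on {0..1} (rod_state B)" using rod_state_minimises(1) by (rule W12_lE)
  have "(\<integral>t. - ((1 - t) * sin (rod_state B t)) \<partial>unit_int) \<le> (\<integral>t. (1 - t) * \<bar>sin (rod_state B t)\<bar> \<partial>unit_int)"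
  proof (rule integral_mono)
    fix t assume "t \<in> space unit_int"
    then have "(1 - t) * (- sin (rod_state B t)) \<le> (1 - t) * \<bar>sin (rod_state B t)\<bar>"
      by (intro mult_left_mono) auto
    then show "- ((1 - t) * sin (rod_state B t)) \<le> (1 - t) * \<bar>sin (rod_state B t)\<bar>" by simp
  qed (use load_integrable[OF K] in auto)
  then have "- potential (rod_state B) \<le> compliance B" by (simp add: potential_def compliance_eq)
  then show ?thesis
    using potential_le_energy[OF rod_state_minimises(1)] rod_state_minimises(2)[OF assms] by simp
qed

text \<open>The trial state is quadratic in \<open>t - V\<close> beyond \<open>V\<close>, so that it
  is continuously differentiable across \<open>V\<close>. \<open>d\<close> is a third of the soft
  part: on its middle third, of length \<open>d\<close>, both \<open>q t \<ge> d\<^sup>2\<close> and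
  \<open>1 - t \<ge> d\<close> hold, and the load gains at least \<open>c * d ^ 4 / 2\<close>.
  Bending costs at most \<open>2 * a * c\<^sup>2\<close>, and \<open>c \<le> d ^ 4 / (8 * a)\<close>
  keeps this below half of the gain; \<open>c \<le> 1\<close> keeps \<open>c * q t\<close> in the
  range of \<open>half_le_sin\<close>.\<close>

lemma compliance_lower_of_soft_part:
  assumes V: "0 < V" "V < 1" and a: "0 < a" "\<And>t. V < t \<Longrightarrow> \<beta> t = a"
  defines "d \<equiv> (1 - V) / 3"
  defines "c \<equiv> min 1 (d ^ 4 / (8 * a))"
  shows "c * d ^ 4 / 4 \<le> compliance B"
proof -
  have d: "0 < d" "d < 1" "V + d + d = 1 - d" using V by (auto simp: d_def field_simps)
  have c: "0 < c" "c \<le> 1" "c \<le> d ^ 4 / (8 * a)" using d a by (auto simp: c_def)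
  \<comment> \<open>The trial state bends only in the soft part, so its energy does not depend on \<open>b\<close>.\<close>
  define q where "q t = (max 0 (t - V))\<^sup>2" for t
  define L where "L t = - c * q t" for t
  define L' where "L' t = - c * (2 * max 0 (t - V))" for t
  have "((\<lambda>t. t - V) has_real_derivative 1) (at t)" for t by (auto intro!: derivative_eq_intros)
  from DERIV_cmult[OF DERIV_chain2[OF DERIV_max_0_power2 this], of "- c"]
  have "(L has_real_derivative L' t) (at t)" for t by (simp add: L_def[abs_def] L'_def q_def)
  moreover have "continuous_on UNIV L'" unfolding L'_def by (intro continuous_intros)
  ultimately have wL: "has_weak_derivative L L'" by (rule has_weak_derivative_C1)
  have cL: "continuous_on {0..1} L" unfolding L_def q_def by (intro continuous_intros)
  have LW: "L \<in> W12_l" by (rule W12_lI[OF cL _ wL]) (use V in \<open>simp add: L_def q_def\<close>)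
  have L'2: "L2 unit_int L'" using wL by (simp add: has_weak_derivative_iff)
  have "\<bar>\<integral>t. \<beta> t * (L' t)\<^sup>2 \<partial>unit_int\<bar> \<le> 4 * a * c\<^sup>2"
  proof (rule abs_integral_unit_int_le)
    show "integrable unit_int (\<lambda>t. \<beta> t * (L' t)\<^sup>2)"
      using \<beta>_integrable[OF L'2 L'2] by (simp add: power2_eq_square mult.assoc)
    fix t :: real assume t: "t \<in> {0<..<1}"
    show "\<bar>\<beta> t * (L' t)\<^sup>2\<bar> \<le> 4 * a * c\<^sup>2"
    proof (cases "V < t")
      case True
      then have "(t - V)\<^sup>2 \<le> 1\<^sup>2" using t V by (intro power_mono) auto
      then have "4 * a * c\<^sup>2 * (t - V)\<^sup>2 \<le> 4 * a * c\<^sup>2 * 1"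
        using a by (intro mult_left_mono) auto
      moreover have "\<beta> t * (L' t)\<^sup>2 = 4 * a * c\<^sup>2 * (t - V)\<^sup>2"
        using True a(2) by (simp add: L'_def power2_eq_square algebra_simps)
      ultimately show ?thesis using a(1) by simp
    next
      \<comment> \<open>\<open>L'\<close> vanishes up to \<open>V\<close>, so the values of
        \<open>\<beta>\<close> on the hard part do not enter.\<close>
      case False
      then show ?thesis using a by (simp add: L'_def)
    qed
  qed
  then have bend: "(\<integral>t. \<beta> t * (L' t)\<^sup>2 \<partial>unit_int) \<le> 4 * a * c\<^sup>2" by simp
  have "(\<integral>t. c * d ^ 3 / 2 * indicat_real {V + d<..<1 - d} t \<partial>unit_int) \<le> (\<integral>t. - ((1 - t) * sin (L t)) \<partial>unit_int)"
  proof (rule integral_mono)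
    show "integrable unit_int (\<lambda>t. - ((1 - t) * sin (L t)))" using load_integrable(1)[OF cL] by simp
    show "integrable unit_int (\<lambda>t. c * d ^ 3 / 2 * indicat_real {V + d<..<1 - d} t)"
      using L2_integrable[OF finite_measure_unit_int
          indicator_mult_L2[OF L2_const[OF finite_measure_unit_int, of "c * d ^ 3 / 2"], of "{V + d<..<1 - d}"]]
      by (simp add: mult.commute)
    fix t assume "t \<in> space unit_int"
    then have t: "0 < t" "t < 1" by auto
    have q: "0 \<le> q t" "q t \<le> 1"
      using t V by (auto simp: q_def abs_square_le_1)
    have "c * q t / 2 \<le> sin (c * q t)"
      using c q by (intro half_le_sin) (auto intro: mult_le_one)
    then have 1: "(1 - t) * (c * q t / 2) \<le> (1 - t) * sin (c * q t)"
      using t by (intro mult_left_mono) auto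
    have "c * d ^ 3 / 2 * indicat_real {V + d<..<1 - d} t \<le> (1 - t) * (c * q t / 2)"
    proof (cases "t \<in> {V + d<..<1 - d}")
      case True
      then have "d * (c * d\<^sup>2 / 2) \<le> (1 - t) * (c * q t / 2)"
        using d c unfolding q_def by (intro mult_mono divide_right_mono mult_left_mono power_mono) auto
      then show ?thesis using True by (simp add: power3_eq_cube power2_eq_square mult_ac)
    next
      case False
      then show ?thesis using t c q by simp
    qed
    with 1 show "c * d ^ 3 / 2 * indicat_real {V + d<..<1 - d} t \<le> - ((1 - t) * sin (L t))"
      by (simp add: L_def)
  qed
  moreover have "(\<integral>t. indicat_real {V + d<..<1 - d} t \<partial>unit_int) = d"
    using d V by (subst integral_indicator_Ioo_unit_int) auto
  ultimately have "c * d ^ 3 / 2 * d \<le> - potential L"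
    by (simp add: potential_def)
  then have load: "c * d ^ 4 / 2 \<le> - potential L" by (simp add: power_Suc2 numeral_eq_Suc mult.assoc)
  have "2 * a * c\<^sup>2 \<le> c * d ^ 4 / 4"
    using mult_left_mono[OF c(3), of "2 * a * c"] a c(1) by (simp add: power2_eq_square field_simps)
  then have "energy B L \<le> - (c * d ^ 4 / 4)"
    using energy_eq[OF LW wL] bend load by simp
  then show ?thesis using compliance_lower[OF LW] by simp
qed

end

section \<open>The two designs\<close>

lemma cross_section_mean_design_I:
  "cross_section_mean (design_I V a b) = (\<lambda>t. indicator {0<..<V} t * b + indicator {V<..<1} t * a)"
  by (simp add: fun_eq_iff cross_section_mean_def design_I_def set_lebesgue_integral_def)

lemma cross_section_mean_design_II:
  assumes "0 < V" "V < 1"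
  shows "cross_section_mean (design_II V a b) t = V * b + (1 - V) * a"
proof -
  have "cross_section_mean (design_II V a b) t
      = (\<integral>x. (b - a) * indicat_real {-V/2<..<V/2} x + a * indicat_real {-1/2<..<1/2} x \<partial>lebesgue)"
    unfolding cross_section_mean_def set_lebesgue_integral_def
    by (rule Bochner_Integration.integral_cong)
      (use assms in \<open>auto simp: design_II_def indicator_def algebra_simps\<close>)
  also have "\<dots> = (b - a) * V + a"
    using assms by simp
  finally show ?thesis by (simp add: algebra_simps)
qed

lemma AE_ne_lebesgue: "AE t in lebesgue. t \<noteq> (c::real)"
  by (rule AE_I'[of "{c}"]) (auto simp: null_sets_completionI)

lemma rod_design_I:
  assumes "0 < V" "V < 1" "0 < a" "a < b"
  shows "rod (design_I V a b) (\<lambda>t. if t < V then b else a) a b"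
proof
  show "0 < a" by fact
  show "a \<le> (if t < V then b else a)" "(if t < V then b else a) \<le> b" for t using assms by auto
  show "(\<lambda>t. if t < V then b else a) \<in> borel_measurable unit_int"
    by (rule measurable_restrict_space1, rule measurable_completion) simp
  show "cross_section_mean (design_I V a b) \<in> borel_measurable unit_int"
    unfolding cross_section_mean_design_I
    by (rule measurable_restrict_space1, rule measurable_completion) simp
  show "AE t in unit_int. cross_section_mean (design_I V a b) t = (if t < V then b else a)"
    unfolding cross_section_mean_design_I
    using AE_ne_lebesgue[of V]
    by (subst AE_restrict_space_iff) (auto elim!: eventually_mono simp: indicator_def)
qed

text \<open>The lower bound \<open>V * b\<close> is simpler than the mean itself and still grows
  with \<open>b\<close>.\<close>

lemma rod_design_II:
  assumes "0 < V" "V < 1" "0 < a" "a < b"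
  shows "rod (design_II V a b) (\<lambda>t. V * b + (1 - V) * a) (V * b) (V * b + (1 - V) * a)"
proof -
  have "cross_section_mean (design_II V a b) = (\<lambda>t. V * b + (1 - V) * a)"
    using cross_section_mean_design_II[OF assms(1,2)] by blast
  then show ?thesis using assms by unfold_locales simp_all
qed

section \<open>Phases and hard-phase areas of the two designs\<close>

lemma measure_lebesgue_Ioo_times_Ioo:
  assumes "p \<le> q" "r \<le> (s::real)"
  shows "measure lebesgue ({p<..<q::real} \<times> {r<..<s}) = (q - p) * (s - r)"
proof -
  have "{p<..<q} \<times> {r<..<s} \<in> sets lborel" by (simp add: open_Times)
  then have "emeasure lebesgue ({p<..<q} \<times> {r<..<s}) = emeasure (lborel \<Otimes>\<^sub>M lborel) ({p<..<q} \<times> {r<..<s})"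
    by (simp add: lborel_prod)
  also have "\<dots> = ennreal ((q - p) * (s - r))"
    using assms by (subst lborel.emeasure_pair_measure_Times) (auto simp: ennreal_mult)
  finally show ?thesis using assms by (simp add: measure_def)
qed

lemma design_measurable:
  "set_borel_measurable lebesgue rod_domain (design_I V a b)"
  "set_borel_measurable lebesgue rod_domain (design_II V a b)"
proof -
  have [measurable]: "rod_domain \<in> sets (borel \<Otimes>\<^sub>M borel)" by (simp add: rod_domain_def)
  have "design_I V a b \<in> borel_measurable (borel \<Otimes>\<^sub>M borel)"
    "design_II V a b \<in> borel_measurable (borel \<Otimes>\<^sub>M borel)"
    unfolding design_I_def design_II_def by measurable
  then show "set_borel_measurable lebesgue rod_domain (design_I V a b)"
    "set_borel_measurable lebesgue rod_domain (design_II V a b)"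
    unfolding set_borel_measurable_def
    by (auto simp: borel_prod[symmetric] intro!: measurable_completion)
qed

text \<open>On the line \<open>fst x = V\<close> the design has the value 0; the line is a
  hyperplane and thus a null set.\<close>

lemma two_phase_design_I: "two_phase_design a b (design_I V a b)"
proof -
  have "(\<lambda>x::real \<times> real. x \<bullet> (1, 0) = V) = (\<lambda>x. fst x = V)" by (auto simp: fun_eq_iff)
  moreover have "negligible {x::real \<times> real. x \<bullet> (1, 0) = V}"
    by (rule negligible_standard_hyperplane) (simp add: Basis_prod_def)
  ultimately have "{x::real \<times> real. fst x = V} \<in> null_sets lebesgue"
    by (simp add: negligible_iff_null_sets)
  then have "AE x in lebesgue. fst (x::real \<times> real) \<noteq> V"
    by (rule AE_I') auto
  then have "AE x \<in> rod_domain in lebesgue. design_I V a b x \<in> {a, b}"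
    by eventually_elim (auto simp: rod_domain_def design_I_def indicator_def)
  then show ?thesis using design_measurable by (simp add: two_phase_design_def)
qed

lemma two_phase_design_II: "two_phase_design a b (design_II V a b)"
proof -
  have "design_II V a b x \<in> {a, b}" for x
    by (cases x) (auto simp: design_II_def indicator_def)
  then show ?thesis using design_measurable by (simp add: two_phase_design_def)
qed

lemma hard_phase_area_design_I:
  assumes "0 < V" "V < 1" "0 < a" "a < b"
  shows "hard_phase_area b (design_I V a b) = V"
proof -
  \<comment> \<open>The value 0 on the interface differs from \<open>b\<close> because
    \<open>0 < a < b\<close>, so the hard phase is exactly an open rectangle.\<close>
  have "{x \<in> rod_domain. design_I V a b x = b} = {0<..<V} \<times> {-1/2<..<1/2}"
    using assms by (auto simp: rod_domain_def design_I_def indicator_def of_bool_def split: if_splits)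
  then show ?thesis
    unfolding hard_phase_area_def using assms by (simp add: measure_lebesgue_Ioo_times_Ioo)
qed

lemma hard_phase_area_design_II:
  assumes "0 < V" "V < 1" "a < b"
  shows "hard_phase_area b (design_II V a b) = V"
proof -
  have "{x \<in> rod_domain. design_II V a b x = b} = {0<..<1} \<times> {-V/2<..<V/2}"
    using assms by (auto simp: rod_domain_def design_II_def indicator_def of_bool_def split: if_splits)
  then show ?thesis
    unfolding hard_phase_area_def using assms by (simp add: measure_lebesgue_Ioo_times_Ioo)
qed

theorem mainTheorem2:
  fixes V a :: real
  assumes "0 < V" and "V < 1" and "0 < a"
  shows "\<exists>b0\<ge>a. \<forall>b>b0.
           two_phase_design a b (design_I V a b) \<and>
           two_phase_design a b (design_II V a b) \<and>
           hard_phase_area b (design_I V a b) = V \<and>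
           hard_phase_area b (design_II V a b) = V \<and>
           compliance (design_II V a b) < compliance (design_I V a b)"
proof -
  \<comment> \<open>The constants of \<open>compliance_lower_of_soft_part\<close>; none of them
    involves \<open>b\<close>.\<close>
  define d where "d = (1 - V) / 3"
  define c where "c = min 1 (d ^ 4 / (8 * a))"
  define \<delta> where "\<delta> = c * d ^ 4 / 4"
  have "0 < d" using assms by (simp add: d_def)
  then have "0 < \<delta>" using assms by (simp add: \<delta>_def c_def)
  have less: "compliance (design_II V a b) < compliance (design_I V a b)"
    if b: "a < b" "2 / (V * \<delta>\<^sup>2) < b" for b
  proof -
    interpret I: rod "design_I V a b" "\<lambda>t. if t < V then b else a" a b
      using assms b(1) by (rule rod_design_I)
    interpret II: rod "design_II V a b" "\<lambda>t. V * b + (1 - V) * a" "V * b" "V * b + (1 - V) * a"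
      using assms b(1) by (rule rod_design_II)
    \<comment> \<open>The origin of the threshold: with \<open>\<alpha> = V * b\<close> the bound of
      \<open>compliance_upper\<close> is below \<open>\<delta>\<close> once \<open>b\<close> exceeds
      \<open>2 / (V * \<delta>\<^sup>2)\<close>.\<close>
    have "2 / (V * b) < \<delta>\<^sup>2" using b assms \<open>0 < \<delta>\<close> by (simp add: field_simps)
    then have "sqrt (2 / (V * b)) < sqrt (\<delta>\<^sup>2)" by (rule real_sqrt_less_mono)
    then have "compliance (design_II V a b) < \<delta>"
      using II.compliance_upper \<open>0 < \<delta>\<close> by simp
    also have "\<delta> \<le> compliance (design_I V a b)"
      unfolding \<delta>_def c_def d_def
      by (rule I.compliance_lower_of_soft_part) (use assms in auto)
    finally show ?thesis .
  qed
  show ?thesis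
  proof (intro exI[of _ "max a (2 / (V * \<delta>\<^sup>2))"] conjI allI impI)
    fix b assume "max a (2 / (V * \<delta>\<^sup>2)) < b"
    then have b: "a < b" "2 / (V * \<delta>\<^sup>2) < b" by auto
    show "two_phase_design a b (design_I V a b)" by (rule two_phase_design_I)
    show "two_phase_design a b (design_II V a b)" by (rule two_phase_design_II)
    show "hard_phase_area b (design_I V a b) = V" using assms b(1) by (rule hard_phase_area_design_I)
    show "hard_phase_area b (design_II V a b) = V" using assms(1,2) b(1) by (rule hard_phase_area_design_II)
    show "compliance (design_II V a b) < compliance (design_I V a b)" using b by (rule less)
  qed simp
qed

end
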